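(* Let $N\ge p-1$. The stationary distribution $\pi^{[N]}=(\pi^{[N]}_1,\dots,\pi^{[N]}_{N+1})$ of both stochastic matrices $\tilde P^{[N]}_{II}$ and $\tilde P^{[N]}_{I}$ has the components $$\pi^{[N]}_n=u_{1,n}w_{1,n}=\Big(A^{(1)}_{n-1}(\lambda^{[N]}_{1})\mu^{[N]}_{1,1}+\cdots+A^{(p)}_{n-1}(\lambda^{[N]}_{1})\mu^{[N]}_{1,p}\Big)B_{n-1}(\lambda^{[N]}_{1})=\frac{B^{[n]}_{N+1}(\lambda^{[N]}_{1})\,B_{n-1}(\lambda^{[N]}_{1})}{B'_{N+1}(\lambda^{[N]}_{1})},\quad n\in\{1,\dots,N+1\}.$$
   Context: Fix an integer $p\ge 1$; $\mathbb N_0=\{0,1,2,\dots\}$. $T=(T_{i,j})_{i,j\ge 0}$ is a real semi-infinite monic banded lower Hessenberg matrix: $T_{n,n+1}=1$, $T_{i,j}=0$ if $j>i+1$ or $j<i-p$, and $T_{n,n-p}\neq0$ for $n\ge p$. $T^{[N]}=(T_{i,j})_{0\le i,j\le N}$. $T$ admits a positive bidiagonal factorization: $T=L_1\cdots L_pU$, where $L_k$ is lower bidiagonal with unit diagonal and $(L_k)_{j+1,j}=\alpha_{k+1+j(p+1)}$, $U$ is upper bidiagonal with unit superdiagonal and $U_{j,j}=\alpha_{1+j(p+1)}$ ($j\in\mathbb N_0$), and all $\alpha_i>0$. Moreover $T$ is associated with a semi-infinite stochastic matrix: there is a diagonal matrix $\pi$ with positive diagonal entries such that $\pi T\pi^{-1}$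 or $\pi^{-1}T^\top\pi$ is stochastic. Type II polynomials: $B_0=1$, $B_{n+1}=(x-T_{n,n})B_n-T_{n,n-1}B_{n-1}-\cdots-T_{n,n-p}B_{n-p}$ (terms with negative index are $0$). Type I polynomials: given a real lower unitriangular $p\times p$ matrix $\nu$, $A^{(a)}_{j}=\nu_{j+1,a}$ for $0\le j\le p-1$, $A^{(a)}_{-1}=0$, and $A^{(a)}_{n-1}+T_{n,n}A^{(a)}_n+\cdots+T_{n+p,n}A^{(a)}_{n+p}=xA^{(a)}_n$, $n\in\mathbb N_0$, $a\in\{1,\dots,p\}$. The zeros of $B_{N+1}$ (eigenvalues of $T^{[N]}$) are simple and positive, $\lambda^{[N]}_1>\cdots>\lambda^{[N]}_{N+1}>0$. Let $\mathscr U=(B_{i-1}(\lambda^{[N]}_j))_{1\le i,j\le N+1}$, whose $k$-th column is $u_k$, $u_{k,n}=B_{n-1}(\lambda_k^{[N]})$ (right eigenvectors), and $\mathscr W=\mathscr U^{-1}=(w_{k,n})$, whose $k$-th row is $w_k$ (biorthogonal left eigenvectors). Christoffel numbers: $(\mu^{[N]}_{k,1},\dots,\mu^{[N]}_{k,p})^\top=\nu^{-1}(w_{k,1},\dots,w_{k,p})^\top$. Truncated polynomials: $B^{[k]}_{N+1}(x)=\det(xI_{N+1-k}-T^{[N,k]})$ with $T^{[N,k]}=(T_{i,j})_{k\le i,j\le N}$, and $B^{[N+1]}_{N+1}=1$. The finite stochastic matrices are $\tilde P^{[N]}_{II}=\tilde\pi_{II}\,\frac{T^{[N]}}{\lambda_1^{[N]}}\,\tilde\pi_{II}^{-1}$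 and $\tilde P^{[N]}_{I}=\tilde\pi_{I}^{-1}\,\frac{(T^{[N]})^\top}{\lambda_1^{[N]}}\,\tilde\pi_{I}$, where $\tilde\pi_{II}=\mathrm{diag}(\tilde\pi_{II,0},\dots,\tilde\pi_{II,N})$, $\tilde\pi_{II,n}=1/B_n(\lambda_1^{[N]})$, and $\tilde\pi_{I}=\mathrm{diag}(\tilde\pi_{I,0},\dots,\tilde\pi_{I,N})$, $\tilde\pi_{I,n}=B^{[n+1]}_{N+1}(\lambda_1^{[N]})/B^{[1]}_{N+1}(\lambda_1^{[N]})$ (all these numbers are positive). A stationary distribution of a stochastic matrix $P$ is a probability row vector $\varpi$ with $\varpi P=\varpi$. *)

theory Defs
  imports
    Complex_Main
    "Jordan_Normal_Form.Char_Poly"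
    "Jordan_Normal_Form.Gauss_Jordan_Elimination"
begin

text \<open>
  Semi-infinite matrices are functions on pairs of naturals, with rows and columns numbered
  from 0. Finite matrices and vectors are those of the Jordan normal form library, also numbered
  from 0; the accessor functions below (zeros, eigenvector entries, Christoffel
  numbers) are numbered from 1, as in the usual mathematical notation.
\<close>

type_synonym smat = "nat \<Rightarrow> nat \<Rightarrow> real"

definition monic_banded_hessenberg :: "nat \<Rightarrow> smat \<Rightarrow> bool" where
  "monic_banded_hessenberg p T \<longleftrightarrow>
     (\<forall>n. T n (n + 1) = 1) \<and>
     (\<forall>i j. j > i + 1 \<or> j + p < i \<longrightarrow> T i j = 0) \<and>
     (\<forall>n \<ge> p. T n (n - p) \<noteq> 0)"

text \<open>The product is only used with a left factor all of whose rows are finitely supported.\<close>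

definition smat_mult :: "smat \<Rightarrow> smat \<Rightarrow> smat" where
  "smat_mult A B = (\<lambda>i j. \<Sum>k | A i k \<noteq> 0. A i k * B k j)"

definition lower_bidiag :: "nat \<Rightarrow> (nat \<Rightarrow> real) \<Rightarrow> nat \<Rightarrow> smat" where
  "lower_bidiag p \<alpha> k = (\<lambda>i j.
     if i = j then 1 else if i = j + 1 then \<alpha> (k + 1 + j * (p + 1)) else 0)"

definition upper_bidiag :: "nat \<Rightarrow> (nat \<Rightarrow> real) \<Rightarrow> smat" where
  "upper_bidiag p \<alpha> = (\<lambda>i j.
     if i = j then \<alpha> (1 + j * (p + 1)) else if j = i + 1 then 1 else 0)"

definition positive_bidiagonal_factorization :: "nat \<Rightarrow> smat \<Rightarrow> bool" where
  "positive_bidiagonal_factorization p T \<longleftrightarrow>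
     (\<exists>\<alpha>. (\<forall>i \<ge> 1. \<alpha> i > 0) \<and>
        T = foldr smat_mult (map (lower_bidiag p \<alpha>) [1..<p + 1]) (upper_bidiag p \<alpha>))"

definition semi_infinite_stochastic :: "smat \<Rightarrow> bool" where
  "semi_infinite_stochastic P \<longleftrightarrow> (\<forall>i j. P i j \<ge> 0) \<and> (\<forall>i. (\<lambda>j. P i j) sums 1)"

definition associated_with_stochastic :: "smat \<Rightarrow> bool" where
  "associated_with_stochastic T \<longleftrightarrow>
     (\<exists>d :: nat \<Rightarrow> real. (\<forall>n. d n > 0) \<and>
        (semi_infinite_stochastic (\<lambda>i j. d i * T i j * inverse (d j)) \<or>
         semi_infinite_stochastic (\<lambda>i j. inverse (d i) * T j i * d j)))"

text \<open>
  Type II polynomials. Truncated subtraction makes the sum run over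
  \<open>max 0 (n - p) \<le> j < n\<close>, so terms of negative index are absent.
\<close>

fun typeII :: "nat \<Rightarrow> smat \<Rightarrow> nat \<Rightarrow> real poly" where
  "typeII p T 0 = 1"
| "typeII p T (Suc n) = [:- T n n, 1:] * typeII p T n
     - (\<Sum>j\<in>{n - p..<n}. Polynomial.smult (T n j) (typeII p T j))"

definition lower_unitriangular :: "nat \<Rightarrow> real mat \<Rightarrow> bool" where
  "lower_unitriangular p \<nu> \<longleftrightarrow> \<nu> \<in> carrier_mat p p \<and>
     (\<forall>i<p. \<nu> $$ (i, i) = 1) \<and> (\<forall>i<p. \<forall>j<p. i < j \<longrightarrow> \<nu> $$ (i, j) = 0)"

text \<open>
  Type I polynomials, \<open>typeI p T \<nu> a n\<close> with \<open>1 \<le> a \<le> p\<close>: the defining recurrence, solved for its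
  last term. Its usual form is lemma \<open>typeI_recurrence\<close> below.
\<close>

fun typeI :: "nat \<Rightarrow> smat \<Rightarrow> real mat \<Rightarrow> nat \<Rightarrow> nat \<Rightarrow> real poly" where
  "typeI p T \<nu> a n =
     (if p = 0 \<or> n < p then [: \<nu> $$ (n, a - 1) :]
      else Polynomial.smult (inverse (T n (n - p)))
        ([:0, 1:] * typeI p T \<nu> a (n - p)
         - (if n = p then 0 else typeI p T \<nu> a (n - p - 1))
         - (\<Sum>i<p. Polynomial.smult (T (n - p + i) (n - p)) (typeI p T \<nu> a (n - p + i)))))"

declare typeI.simps [simp del]

lemma typeI_initial:
  assumes "j < p"
  shows "typeI p T \<nu> a j = [: \<nu> $$ (j, a - 1) :]"
  using assms by (simp add: typeI.simps)

lemma typeI_recurrence: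
  assumes "p \<ge> 1" and "monic_banded_hessenberg p T"
  shows "(if n = 0 then 0 else typeI p T \<nu> a (n - 1))
           + (\<Sum>i\<le>p. Polynomial.smult (T (n + i) n) (typeI p T \<nu> a (n + i)))
         = [:0, 1:] * typeI p T \<nu> a n"
proof -
  have "T (n + p) n \<noteq> 0"
    using assms(2) unfolding monic_banded_hessenberg_def
    by (metis add_diff_cancel_right' le_add2)
  then have "Polynomial.smult (T (n + p) n) (typeI p T \<nu> a (n + p)) =
      [:0, 1:] * typeI p T \<nu> a n - (if n = 0 then 0 else typeI p T \<nu> a (n - 1))
         - (\<Sum>i<p. Polynomial.smult (T (n + i) n) (typeI p T \<nu> a (n + i)))"
    using assms(1) by (subst typeI.simps) (simp add: Let_def)
  then show ?thesis
    by (simp add: lessThan_Suc_atMost [symmetric])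
qed

text \<open>
  \<open>trunc_mat T N k\<close> is the block of \<open>T\<close> with rows and columns from \<open>k\<close> to \<open>N\<close>; it is empty
  for \<open>k = N + 1\<close>.
\<close>

definition trunc_mat :: "smat \<Rightarrow> nat \<Rightarrow> nat \<Rightarrow> real mat" where
  "trunc_mat T N k = mat (N + 1 - k) (N + 1 - k) (\<lambda>(i, j). T (k + i) (k + j))"

definition trunc_poly :: "smat \<Rightarrow> nat \<Rightarrow> nat \<Rightarrow> real poly" where
  "trunc_poly T N k = char_poly (trunc_mat T N k)"

lemma trunc_poly_last: "trunc_poly T N (N + 1) = 1"
  by (simp add: trunc_poly_def trunc_mat_def char_poly_def char_poly_matrix_def)

text \<open>
  \<open>typeII_zero p T N k\<close> is the \<open>k\<close>-th largest zero of \<open>typeII p T (N + 1)\<close>, for \<open>1 \<le> k \<le> N + 1\<close>.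
\<close>

definition typeII_zero :: "nat \<Rightarrow> smat \<Rightarrow> nat \<Rightarrow> nat \<Rightarrow> real" where
  "typeII_zero p T N k = rev (sorted_list_of_set {x. poly (typeII p T (N + 1)) x = 0}) ! (k - 1)"

definition right_eigenmat :: "nat \<Rightarrow> smat \<Rightarrow> nat \<Rightarrow> real mat" where
  "right_eigenmat p T N =
     mat (N + 1) (N + 1) (\<lambda>(i, j). poly (typeII p T i) (typeII_zero p T N (j + 1)))"

definition left_eigenmat :: "nat \<Rightarrow> smat \<Rightarrow> nat \<Rightarrow> real mat" where
  "left_eigenmat p T N = the (mat_inverse (right_eigenmat p T N))"

text \<open>\<open>n\<close>-th entry of the \<open>k\<close>-th right (left) eigenvector; the right ones are columns.\<close>

definition right_evec :: "nat \<Rightarrow> smat \<Rightarrow> nat \<Rightarrow> nat \<Rightarrow> nat \<Rightarrow> real" where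
  "right_evec p T N k n = right_eigenmat p T N $$ (n - 1, k - 1)"

definition left_evec :: "nat \<Rightarrow> smat \<Rightarrow> nat \<Rightarrow> nat \<Rightarrow> nat \<Rightarrow> real" where
  "left_evec p T N k n = left_eigenmat p T N $$ (k - 1, n - 1)"

definition christoffel :: "nat \<Rightarrow> smat \<Rightarrow> real mat \<Rightarrow> nat \<Rightarrow> nat \<Rightarrow> nat \<Rightarrow> real" where
  "christoffel p T \<nu> N k a =
     (the (mat_inverse \<nu>) *\<^sub>v vec p (\<lambda>i. left_evec p T N k (i + 1))) $ (a - 1)"

definition pi_II :: "nat \<Rightarrow> smat \<Rightarrow> nat \<Rightarrow> nat \<Rightarrow> real" where
  "pi_II p T N n = 1 / poly (typeII p T n) (typeII_zero p T N 1)"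

definition pi_I :: "nat \<Rightarrow> smat \<Rightarrow> nat \<Rightarrow> nat \<Rightarrow> real" where
  "pi_I p T N n =
     poly (trunc_poly T N (n + 1)) (typeII_zero p T N 1) / poly (trunc_poly T N 1) (typeII_zero p T N 1)"

definition P_II :: "nat \<Rightarrow> smat \<Rightarrow> nat \<Rightarrow> real mat" where
  "P_II p T N =
     mat_diag (N + 1) (pi_II p T N)
     * ((1 / typeII_zero p T N 1) \<cdot>\<^sub>m trunc_mat T N 0)
     * mat_diag (N + 1) (\<lambda>n. inverse (pi_II p T N n))"

definition P_I :: "nat \<Rightarrow> smat \<Rightarrow> nat \<Rightarrow> real mat" where
  "P_I p T N =
     mat_diag (N + 1) (\<lambda>n. inverse (pi_I p T N n))
     * ((1 / typeII_zero p T N 1) \<cdot>\<^sub>m transpose_mat (trunc_mat T N 0))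
     * mat_diag (N + 1) (pi_I p T N)"

definition stochastic_mat :: "real mat \<Rightarrow> bool" where
  "stochastic_mat P \<longleftrightarrow> square_mat P \<and>
     (\<forall>i < dim_row P. \<forall>j < dim_col P. P $$ (i, j) \<ge> 0) \<and>
     (\<forall>i < dim_row P. (\<Sum>j < dim_col P. P $$ (i, j)) = 1)"

text \<open>The row vector equation \<open>v P = v\<close> is written with the transpose of \<open>P\<close>.\<close>

definition stationary_distribution :: "real mat \<Rightarrow> real vec \<Rightarrow> bool" where
  "stationary_distribution P v \<longleftrightarrow> v \<in> carrier_vec (dim_row P) \<and>
     (\<forall>i < dim_vec v. v $ i \<ge> 0) \<and> (\<Sum>i < dim_vec v. v $ i) = 1 \<and>
     transpose_mat P *\<^sub>v v = v"

end

theory Submission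
  imports Defs
begin

text \<open>
  Let \<open>\<lambda>\<close> be the largest zero of \<open>B\<^bsub>N+1\<^esub>\<close>. The finite section of \<open>T\<close> is a nonnegative matrix that has the right
  eigenvector \<open>r = (B\<^sub>0(\<lambda>), \<dots>, B\<^sub>N(\<lambda>))\<close> and, as the expansion of Hessenberg determinants shows
  (\<open>trunc_poly_recurrence\<close>), the left eigenvector \<open>l\<close> of truncated characteristic polynomials at
  \<open>\<lambda>\<close>. If both and \<open>\<lambda>\<close> are positive, conjugation by \<open>r\<close>, or of the transpose by \<open>l\<close>, yields a stochastic
  matrix whose stationary distributions correspond to the eigenvectors on the other side. A Hessenberg matrix with
  unit superdiagonal has one-dimensional eigenspaces, so in both cases the stationary distribution is \<open>l\<^sub>n r\<^sub>n\<close>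
  divided by its sum (\<open>doob_transform\<close>). The confluent Christoffel-Darboux identity evaluates that sum as
  \<open>B'\<^bsub>N+1\<^esub>(\<lambda>)\<close>. The same identity at two distinct zeros inverts the matrix of right eigenvectors
  (\<open>left_evec_eq\<close>), which identifies \<open>l\<close> with the biorthogonal left eigenvector; the expression by type I
  polynomials and Christoffel numbers follows because both solve the same recurrence with the same initial values
  (\<open>typeI_christoffel\<close>).

  What remains is that \<open>B\<^bsub>N+1\<^esub>\<close> has \<open>N + 1\<close> distinct positive zeros, and that \<open>r\<close> and \<open>l\<close> are
  positive. This is where the positive bidiagonal factorization enters. Let the factors \<open>U, L\<^sub>p, \<dots>, L\<^sub>1\<close> act in
  turn on the vector of the polynomials \<open>B\<^sub>n(x)\<close>, and scale by powers of \<open>x\<close>. All vectors that occur interleave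
  to a single sequence \<open>s\<^sub>m(t)\<close>, \<open>t = 1/x\<close>, with
  \<open>s\<^bsub>m+p+1\<^esub> = s\<^bsub>m+p\<^esub> - \<alpha>\<^bsub>m+1\<^esub> t s\<^sub>m\<close> and \<open>s\<^sub>0 = \<dots> = s\<^sub>p = 1\<close>.
  For such a three-term recurrence the Wronskians of nearby members have a fixed sign
  (\<open>ladder_poly_wronskian\<close>), so \<open>B\<^bsub>n+1\<^esub>\<close> and \<open>x B\<^sub>n\<close> have a positive
  Wronskian on \<open>x \<ge> 0\<close>. Rolle's theorem then interlaces their zeros (\<open>root_after_root\<close>,
  \<open>typeII_zeros\<close>), and the largest zeros increase with \<open>n\<close>, whence \<open>r > 0\<close>. Positivity of \<open>l\<close> follows from
  that of \<open>r\<close> by a Perron-Frobenius argument (\<open>trunc_poly_pos\<close>).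
\<close>

section \<open>Products of bidiagonal matrices\<close>

text \<open>
  Each row of a lower bidiagonal factor has at most two nonzero entries, so the product with it is a
  two-term row operation; in row \<open>0\<close> only the unit diagonal remains.
\<close>

lemma smat_mult_lower_bidiag:
  "smat_mult (lower_bidiag p \<alpha> k) M i j =
     M i j + (if i = 0 then 0 else lower_bidiag p \<alpha> k i (i - 1) * M (i - 1) j)"
proof -
  let ?L = "lower_bidiag p \<alpha> k"
  have "smat_mult ?L M i j = (\<Sum>l\<in>{i, i - 1}. ?L i l * M l j)"
    unfolding smat_mult_def
    by (rule sum.mono_neutral_left) (auto simp: lower_bidiag_def split: if_splits)
  also have "\<dots> = M i j + (if i = 0 then 0 else ?L i (i - 1) * M (i - 1) j)"
    by (cases i) (auto simp: lower_bidiag_def)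
  finally show ?thesis .
qed

text \<open>
  The factors act one after the other on \<open>b\<close>, from \<open>U\<close> on the right to \<open>L\<^sub>1\<close> on the left, and
  \<open>c k\<close> is the intermediate vector that \<open>L\<^sub>k\<close> receives, \<open>c 0\<close> the final result. This turns the action of \<open>T\<close>, whose entries are
  complicated in terms of \<open>\<alpha>\<close>, into two-term relations.
\<close>

lemma bidiagonal_product_apply:
  fixes \<alpha> b :: "nat \<Rightarrow> real" and c :: "nat \<Rightarrow> nat \<Rightarrow> real"
  assumes U: "\<And>n. \<alpha> (1 + n * (p + 1)) * b n + b (Suc n) = c p n"
    and L: "\<And>k n. k < p \<Longrightarrow>
      c (Suc k) n + (if n = 0 then 0 else \<alpha> (k + 2 + (n - 1) * (p + 1)) * c (Suc k) (n - 1)) = c k n"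
    and T: "T = foldr smat_mult (map (lower_bidiag p \<alpha>) [1..<p + 1]) (upper_bidiag p \<alpha>)"
  shows "(\<Sum>j\<le>Suc n. T n j * b j) = c 0 n"
proof -
  define M where "M k = foldr smat_mult (map (lower_bidiag p \<alpha>) [Suc k..<p + 1]) (upper_bidiag p \<alpha>)" for k
  have "(\<forall>i j. Suc i < j \<longrightarrow> M k i j = 0) \<and> (\<forall>i. (\<Sum>j\<le>Suc i. M k i j * b j) = c k i)" if "k \<le> p" for k
    using that
  proof (induction rule: inc_induct)
    case base
    have M: "M p = upper_bidiag p \<alpha>" by (simp add: M_def)
    have "(\<Sum>j\<le>Suc i. M p i j * b j) = c p i" for i
    proof -
      have "(\<Sum>j<i. M p i j * b j) = 0"
        by (rule sum.neutral) (auto simp: M upper_bidiag_def)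
      then show ?thesis
        using U[of i] by (simp add: M upper_bidiag_def lessThan_Suc_atMost [symmetric])
    qed
    then show ?case by (auto simp: M upper_bidiag_def)
  next
    case (step k)
    have Mk: "M k = smat_mult (lower_bidiag p \<alpha> (Suc k)) (M (Suc k))"
      using step(2) by (simp add: M_def upt_conv_Cons del: upt_Suc)
    have IH: "(\<Sum>j\<le>Suc i. M (Suc k) i j * b j) = c (Suc k) i" for i
      using step(3) by blast
    have "(\<Sum>j\<le>Suc i. M k i j * b j) = c k i" for i
    proof (cases i)
      case 0
      then show ?thesis using IH[of 0] L[of k 0] step(2)
        by (simp add: Mk smat_mult_lower_bidiag)
    next
      case (Suc m)
      have "(\<Sum>j\<le>Suc i. M (Suc k) m j * b j) = c (Suc k) m"
        using step(3) IH[of m] Suc by simp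
      moreover have "(\<Sum>j\<le>Suc i. M k i j * b j) = (\<Sum>j\<le>Suc i. M (Suc k) i j * b j)
          + \<alpha> (k + 2 + m * (p + 1)) * (\<Sum>j\<le>Suc i. M (Suc k) m j * b j)"
      proof -
        have "M k i j = M (Suc k) i j + \<alpha> (k + 2 + m * (p + 1)) * M (Suc k) m j" for j
          unfolding Mk smat_mult_lower_bidiag by (simp add: Suc lower_bidiag_def)
        then show ?thesis by (simp only: sum_distrib_left sum.distrib distrib_right mult.assoc)
      qed
      ultimately show ?thesis using IH[of i] L[of k i] step(2) Suc by simp
    qed
    moreover have "M k i j = 0" if "Suc i < j" for i j
      using step(3) that by (auto simp: Mk smat_mult_lower_bidiag)
    ultimately show ?case by blast
  qed
  moreover have "T = M 0" by (simp add: T M_def)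
  ultimately show ?thesis by simp
qed

lemma lower_bidiag_nonneg:
  assumes "\<And>i. i \<ge> 1 \<Longrightarrow> \<alpha> i > 0"
  shows "lower_bidiag p \<alpha> k i j \<ge> 0"
proof -
  have "\<alpha> (k + 1 + j * (p + 1)) > 0" by (rule assms(1)) simp
  then show ?thesis by (simp add: lower_bidiag_def)
qed

lemma bidiagonal_product_nonneg:
  assumes "\<And>i. i \<ge> 1 \<Longrightarrow> \<alpha> i > 0"
  shows "foldr smat_mult (map (lower_bidiag p \<alpha>) ks) (upper_bidiag p \<alpha>) i j \<ge> 0"
proof (induction ks arbitrary: i)
  case Nil
  then show ?case using assms[of "1 + j * (p + 1)"] by (simp add: upper_bidiag_def)
next
  case (Cons k ks)
  then show ?case
    by (auto simp: smat_mult_lower_bidiag intro!: add_nonneg_nonneg mult_nonneg_nonneg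
        lower_bidiag_nonneg assms)
qed

lemma bidiagonal_product_diag_pos:
  assumes "\<And>i. i \<ge> 1 \<Longrightarrow> \<alpha> i > 0"
  shows "foldr smat_mult (map (lower_bidiag p \<alpha>) ks) (upper_bidiag p \<alpha>) i i > 0"
proof (induction ks)
  case (Cons k ks)
  then show ?case
    by (auto simp: smat_mult_lower_bidiag intro!: add_pos_nonneg mult_nonneg_nonneg
        bidiagonal_product_nonneg lower_bidiag_nonneg assms)
qed (auto simp: upper_bidiag_def assms)

text \<open>
  A single lower bidiagonal factor already suffices: it copies the positive diagonal of the remaining
  product one row down, and nothing can cancel.
\<close>

lemma bidiagonal_product_subdiag_pos:
  assumes "\<And>i. i \<ge> 1 \<Longrightarrow> \<alpha> i > 0" and "ks \<noteq> []"
  shows "foldr smat_mult (map (lower_bidiag p \<alpha>) ks) (upper_bidiag p \<alpha>) (Suc i) i > 0"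
proof -
  obtain k ks' where "ks = k # ks'" using assms(2) by (cases ks) auto
  moreover have "lower_bidiag p \<alpha> k (Suc i) i > 0"
    by (auto simp: lower_bidiag_def assms)
  ultimately show ?thesis
    by (auto simp: smat_mult_lower_bidiag intro!: add_nonneg_pos mult_pos_pos
        bidiagonal_product_nonneg bidiagonal_product_diag_pos assms(1))
qed

lemma positive_bidiagonal_factorization_entries:
  assumes "positive_bidiagonal_factorization p T" and "p \<ge> 1"
  shows "T i j \<ge> 0" and "T (Suc i) i > 0"
proof -
  obtain \<alpha> where \<alpha>: "\<And>i. i \<ge> 1 \<Longrightarrow> \<alpha> i > 0"
    and T: "T = foldr smat_mult (map (lower_bidiag p \<alpha>) [1..<p + 1]) (upper_bidiag p \<alpha>)"
    using assms(1) unfolding positive_bidiagonal_factorization_def by blast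
  show "T i j \<ge> 0" unfolding T by (rule bidiagonal_product_nonneg[OF \<alpha>])
  have "[1..<p + 1] \<noteq> []" using assms(2) by (cases p) (simp_all add: upt_conv_Cons del: upt_Suc)
  with \<alpha> show "T (Suc i) i > 0" unfolding T
    by (rule bidiagonal_product_subdiag_pos)
qed

section \<open>Type II polynomials and the ladder recurrence\<close>

declare typeII.simps(2) [simp del]

lemma typeII_recurrence:
  assumes "monic_banded_hessenberg p T"
  shows "(\<Sum>j\<le>Suc n. T n j * poly (typeII p T j) x) = x * poly (typeII p T n) x"
proof -
  have "(\<Sum>j<n. T n j * poly (typeII p T j) x) = (\<Sum>j\<in>{n - p..<n}. T n j * poly (typeII p T j) x)"
    using assms by (intro sum.mono_neutral_right) (auto simp: monic_banded_hessenberg_def)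
  moreover have "T n (Suc n) = 1" using assms by (simp add: monic_banded_hessenberg_def)
  ultimately show ?thesis
    by (simp add: typeII.simps(2) lessThan_Suc_atMost [symmetric] poly_sum algebra_simps)
qed

text \<open>
  Since the superdiagonal of \<open>T\<close> is \<open>1\<close>, row \<open>n\<close> of \<open>T b = x b\<close> determines \<open>b (n + 1)\<close> from
  the earlier entries.
\<close>

lemma typeII_unique:
  assumes "monic_banded_hessenberg p T"
    and "b 0 = 1" and b: "\<And>n. Suc n \<le> N \<Longrightarrow> (\<Sum>j\<le>Suc n. T n j * b j) = x * b n"
    and "n \<le> N"
  shows "b n = poly (typeII p T n) x"
  using \<open>n \<le> N\<close>
proof (induction n rule: less_induct)
  case (less n)
  show ?case
  proof (cases n)
    case 0
    then show ?thesis using assms(2) by simp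
  next
    case (Suc m)
    have "T m n = 1" using assms(1) Suc by (simp add: monic_banded_hessenberg_def)
    moreover have "(\<Sum>j\<le>m. T m j * b j) = (\<Sum>j\<le>m. T m j * poly (typeII p T j) x)"
      using less Suc by (intro sum.cong) auto
    moreover have "b m = poly (typeII p T m) x" using less Suc by simp
    ultimately show ?thesis
      using b[of m] typeII_recurrence[OF assms(1), of m x] Suc less.prems by simp
  qed
qed

lemma typeII_monic:
  "degree (typeII p T n) = n \<and> lead_coeff (typeII p T n) = 1"
proof (induction n rule: less_induct)
  case (less n)
  show ?case
  proof (cases n)
    case (Suc m)
    let ?q = "[:- T m m, 1:] * typeII p T m"
    let ?s = "\<Sum>j\<in>{m - p..<m}. Polynomial.smult (T m j) (typeII p T j)"
    have m: "degree (typeII p T m) = m" "lead_coeff (typeII p T m) = 1" using less[of m] Suc by blast+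
    then have "typeII p T m \<noteq> 0" by auto
    then have q: "degree ?q = n"
      using m(1) Suc by (subst degree_mult_eq) auto
    have q1: "lead_coeff ?q = 1"
      by (subst lead_coeff_mult) (simp add: m(2))
    have s: "coeff ?s l = 0" if "l \<ge> n" for l
      using less Suc that by (auto simp: coeff_sum intro!: sum.neutral coeff_eq_0)
    have c: "coeff (?q - ?s) n = 1" using q1 s unfolding q by simp
    have "degree (?q - ?s) \<le> n"
      by (rule degree_le) (use q s in \<open>auto intro: coeff_eq_0 simp del: mult_pCons_left\<close>)
    with c have "degree (?q - ?s) = n" by (intro antisym le_degree) auto
    with c show ?thesis using Suc by (simp add: typeII.simps(2))
  qed simp
qed

lemma degree_typeII [simp]: "degree (typeII p T n) = n"
  and lead_coeff_typeII [simp]: "coeff (typeII p T n) n = 1"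
  using typeII_monic[of p T n] by auto

lemma typeII_nonzero: "typeII p T n \<noteq> 0"
  using lead_coeff_typeII[of p T n] by (metis coeff_0 zero_neq_one)

text \<open>
  The vectors that occur between the factors of \<open>T = L\<^sub>1 \<cdots> L\<^sub>p U\<close>, when it acts on the type II
  polynomials, form a single sequence: up to a power of \<open>x\<close> they are these polynomials evaluated at
  \<open>t = 1 / x\<close>. Passing to \<open>1 / x\<close> makes the recurrence the same for all factors; in the variable
  \<open>x\<close> the upper factor would need a different rule.
\<close>

fun ladder_poly :: "nat \<Rightarrow> (nat \<Rightarrow> real) \<Rightarrow> nat \<Rightarrow> real poly" where
  "ladder_poly p \<alpha> m = (if m \<le> p then 1
     else ladder_poly p \<alpha> (m - 1) - Polynomial.smult (\<alpha> (m - p)) ([:0, 1:] * ladder_poly p \<alpha> (m - p - 1)))"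

declare ladder_poly.simps [simp del]

lemma ladder_poly_initial: "m \<le> p \<Longrightarrow> ladder_poly p \<alpha> m = 1"
  by (simp add: ladder_poly.simps)

lemma ladder_poly_step:
  "ladder_poly p \<alpha> (m + p + 1) =
     ladder_poly p \<alpha> (m + p) - Polynomial.smult (\<alpha> (m + 1)) ([:0, 1:] * ladder_poly p \<alpha> m)"
  by (subst ladder_poly.simps) simp

text \<open>
  With \<open>b n = x\<^sup>n s\<^bsub>n(p+1)\<^esub>(1/x)\<close> and \<open>c k n = x\<^sup>n\<^sup>+\<^sup>1 s\<^bsub>n(p+1)+k\<^esub>(1/x)\<close>, where \<open>s\<close> is the ladder sequence,
  the one ladder recurrence is at once the action of \<open>U\<close> and of all the \<open>L\<^sub>k\<close>, and \<open>c 0 = x b\<close> closes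
  the cycle.
\<close>

lemma typeII_eq_ladder_poly:
  assumes band: "monic_banded_hessenberg p T"
    and T: "T = foldr smat_mult (map (lower_bidiag p \<alpha>) [1..<p + 1]) (upper_bidiag p \<alpha>)"
    and x: "x \<noteq> 0"
  shows "poly (typeII p T n) x = x ^ n * poly (ladder_poly p \<alpha> (n * (p + 1))) (1 / x)"
proof -
  let ?s = "\<lambda>m. poly (ladder_poly p \<alpha> m) (1 / x)"
  define b where "b n = x ^ n * ?s (n * (p + 1))" for n
  define c where "c k n = x ^ (n + 1) * ?s (n * (p + 1) + k)" for k n
  have s: "?s (m + p + 1) = ?s (m + p) - \<alpha> (m + 1) * ?s m / x" for m
    by (subst ladder_poly_step) simp
  have "(\<Sum>j\<le>Suc n. T n j * b j) = c 0 n" for n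
  proof (rule bidiagonal_product_apply[OF _ _ T])
    fix n
    show "\<alpha> (1 + n * (p + 1)) * b n + b (Suc n) = c p n"
    proof -
      have "\<alpha> (1 + n * (p + 1)) * ?s (n * (p + 1)) + x * ?s (Suc n * (p + 1)) = x * ?s (n * (p + 1) + p)"
        using s[of "n * (p + 1)"] x by (simp add: field_simps)
      from arg_cong[OF this, of "(*) (x ^ n)"] show ?thesis
        by (simp add: b_def c_def algebra_simps)
    qed
  next
    fix k n assume "k < p"
    show "c (Suc k) n + (if n = 0 then 0 else \<alpha> (k + 2 + (n - 1) * (p + 1)) * c (Suc k) (n - 1)) = c k n"
    proof (cases n)
      case 0
      then show ?thesis using \<open>k < p\<close> by (simp add: c_def ladder_poly_initial)
    next
      case (Suc m)
      have "?s (n * (p + 1) + Suc k) = ?s (n * (p + 1) + k)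
          - \<alpha> (k + 2 + m * (p + 1)) * ?s (m * (p + 1) + Suc k) / x"
        using s[of "m * (p + 1) + Suc k"] by (simp add: Suc algebra_simps)
      then have "x * ?s (n * (p + 1) + Suc k) + \<alpha> (k + 2 + m * (p + 1)) * ?s (m * (p + 1) + Suc k)
          = x * ?s (n * (p + 1) + k)"
        using x by (simp add: field_simps)
      from arg_cong[OF this, of "(*) (x ^ n)"] show ?thesis
        by (simp add: c_def Suc algebra_simps)
    qed
  qed
  moreover have "c 0 n = x * b n" for n by (simp add: b_def c_def)
  ultimately have "b n = poly (typeII p T n) x"
    by (intro typeII_unique[OF band, where N = n]) (auto simp: b_def ladder_poly_initial)
  then show ?thesis by (simp add: b_def)
qed

text \<open>
  At \<open>x = 0\<close> the intermediate vectors may all be taken to be zero, so that only \<open>U b = 0\<close> remains.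
\<close>

lemma typeII_at_zero:
  assumes band: "monic_banded_hessenberg p T"
    and T: "T = foldr smat_mult (map (lower_bidiag p \<alpha>) [1..<p + 1]) (upper_bidiag p \<alpha>)"
  shows "poly (typeII p T n) 0 = (\<Prod>i<n. - \<alpha> (1 + i * (p + 1)))"
proof -
  define b where "b n = (\<Prod>i<n. - \<alpha> (1 + i * (p + 1)))" for n
  have "(\<Sum>j\<le>Suc n. T n j * b j) = 0" for n
    using bidiagonal_product_apply[OF _ _ T, of b "\<lambda>_ _. 0" n] by (simp add: b_def)
  then have "b n = poly (typeII p T n) 0"
    by (intro typeII_unique[OF band, where N = n]) (auto simp: b_def)
  then show ?thesis by (simp add: b_def)
qed

section \<open>Wronskians and zeros of the type II polynomials\<close>

text \<open>
  Write \<open>s\<^sub>m\<close> for the ladder polynomials and \<open>V i j = s\<^sub>i s\<^sub>j' - s\<^sub>i' s\<^sub>j\<close>. Bilinearity of the Wronskian alone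
  does not propagate the sign of \<open>V\<close> along the recurrence; what propagates is the pair of conditions
  \<open>V i j \<ge> 0\<close> and \<open>s\<^sub>i s\<^sub>j + t V i j > 0\<close> for \<open>j < i \<le> j + p\<close>. The second expression is the Wronskian
  of \<open>s\<^sub>i\<close> and \<open>t s\<^sub>j\<close>, and each condition for the new polynomial is a combination, with positive
  coefficients, of both conditions for the old ones. The
  conclusion, for two indices at distance \<open>p + 1\<close>, is the first condition just beyond this range.
\<close>

lemma ladder_poly_wronskian:
  fixes \<alpha> :: "nat \<Rightarrow> real" and t :: real
  assumes \<alpha>: "\<And>i. i \<ge> 1 \<Longrightarrow> \<alpha> i > 0" and t: "t > 0" and p: "p \<ge> 1"
  defines "s \<equiv> \<lambda>m. poly (ladder_poly p \<alpha> m) t"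
    and "s' \<equiv> \<lambda>m. poly (pderiv (ladder_poly p \<alpha> m)) t"
  shows "s (m + p + 1) * s' m - s' (m + p + 1) * s m > 0"
proof -
  define V where "V i j = s i * s' j - s' i * s j" for i j
  have st: "s (m + p + 1) = s (m + p) - \<alpha> (m + 1) * t * s m" for m
    unfolding s_def by (subst ladder_poly_step) simp
  have s't: "s' (m + p + 1) = s' (m + p) - \<alpha> (m + 1) * (s m + t * s' m)" for m
    unfolding s_def s'_def
    by (subst ladder_poly_step) (simp add: pderiv_diff pderiv_smult pderiv_mult pderiv_pCons algebra_simps)
  have V1: "V (m + p + 1) j = V (m + p) j + \<alpha> (m + 1) * (s j * s m + t * V j m)" for m j
    unfolding V_def st s't by (simp add: algebra_simps)
  have V2: "s (m + p + 1) * s j + t * V (m + p + 1) j =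
      (s (m + p) * s j + t * V (m + p) j) + \<alpha> (m + 1) * t\<^sup>2 * V j m" for m j
    unfolding V1 st by (simp add: algebra_simps power2_eq_square)
  have VV: "V i i = 0" for i by (simp add: V_def)
  have key: "V i j \<ge> 0 \<and> s i * s j + t * V i j > 0" if "j < i" "i \<le> j + p" for i j
    using that
  proof (induction i arbitrary: j rule: less_induct)
    case (less i)
    show ?case
    proof (cases "i \<le> p")
      case True
      then show ?thesis using less.prems
        by (simp add: V_def s_def s'_def ladder_poly_initial)
    next
      case False
      define m where "m = i - p - 1"
      have i: "i = m + p + 1" using False by (simp add: m_def)
      have j: "m < j" "j \<le> m + p" using less.prems i by auto
      have a: "\<alpha> (m + 1) > 0" using \<alpha> by simp
      have jm: "V j m \<ge> 0" "s j * s m + t * V j m > 0"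
        using less.IH[of j m] j i by auto
      have top: "V (m + p) j \<ge> 0" using less.IH[of "m + p" j] j i VV[of j]
        by (cases "j = m + p") auto
      have "s (m + p) * s j + t * V (m + p) j + \<alpha> (m + 1) * t\<^sup>2 * V j m > 0"
      proof (cases "j = m + p")
        case False
        then have "s (m + p) * s j + t * V (m + p) j > 0"
          using less.IH[of "m + p" j] j i by auto
        moreover have "\<alpha> (m + 1) * t\<^sup>2 * V j m \<ge> 0" using a jm by simp
        ultimately show ?thesis by linarith
      next
        case True
        \<comment> \<open>Here the first summand is \<open>(s j)\<^sup>2\<close>; at a zero of \<open>s j\<close> the strict inequality comes from the
          last one, as then \<open>t V j m\<close> is itself the positive quantity of the induction hypothesis.\<close>
        show ?thesis
        proof (cases "s j = 0")
          case True
          then have "V j m > 0" using jm t by (simp add: zero_less_mult_iff)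
          then have "\<alpha> (m + 1) * t\<^sup>2 * V j m > 0" using a t by simp
          then show ?thesis using VV[of j] True \<open>j = m + p\<close> by simp
        next
          case False
          then have "s j * s j > 0" by (metis not_real_square_gt_zero)
          moreover have "\<alpha> (m + 1) * t\<^sup>2 * V j m \<ge> 0" using a jm by simp
          ultimately show ?thesis using VV[of j] \<open>j = m + p\<close> by simp
        qed
      qed
      moreover have "V (m + p) j + \<alpha> (m + 1) * (s j * s m + t * V j m) \<ge> 0"
        using top a jm by (simp add: less_imp_le)
      ultimately show ?thesis unfolding i V2 unfolding V1 by blast
    qed
  qed
  have k: "V (m + p) m \<ge> 0" "s (m + p) * s m + t * V (m + p) m > 0" using key[of m "m + p"] p by auto
  have a: "\<alpha> (m + 1) > 0" using \<alpha> by simp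
  have "V (m + p) m + \<alpha> (m + 1) * (s m * s m) > 0"
  proof (cases "s m = 0")
    case True
    then show ?thesis using k t by (simp add: zero_less_mult_iff)
  next
    case False
    then have "s m * s m > 0" by (metis not_real_square_gt_zero)
    then show ?thesis using k a by (simp add: add_nonneg_pos)
  qed
  then have "V (m + p + 1) m > 0" unfolding V1 VV by simp
  then show ?thesis by (simp add: V_def)
qed

text \<open>
  This is the preceding inequality carried over from \<open>t = 1 / x\<close> to \<open>x\<close>: \<open>f\<close> and \<open>g\<close> are
  \<open>x\<^sup>n\<^sup>+\<^sup>1 F(1/x)\<close> and \<open>x\<^sup>n\<^sup>+\<^sup>1 G(1/x)\<close>, a common factor enters the Wronskian as its square, and the
  substitution reverses the sign. At \<open>x = 0\<close> the values of the polynomials are known.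
  The factor \<open>x\<close> in \<open>g\<close> gives \<open>g\<close> the degree of \<open>f\<close> and a zero at the origin; the zeros of \<open>f\<close> then follow those of \<open>g\<close> one by one.
\<close>

lemma typeII_wronskian_pos:
  fixes n :: nat
  assumes band: "monic_banded_hessenberg p T"
    and T: "T = foldr smat_mult (map (lower_bidiag p \<alpha>) [1..<p + 1]) (upper_bidiag p \<alpha>)"
    and \<alpha>: "\<And>i. i \<ge> 1 \<Longrightarrow> \<alpha> i > 0" and p: "p \<ge> 1" and x: "x \<ge> 0"
  defines "f \<equiv> typeII p T (Suc n)" and "g \<equiv> [:0, 1:] * typeII p T n"
  shows "poly (pderiv f) x * poly g x - poly f x * poly (pderiv g) x > 0"
proof (cases "x = 0")
  case True
  have "poly f 0 = - \<alpha> (1 + n * (p + 1)) * poly (typeII p T n) 0"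
    unfolding f_def typeII_at_zero[OF band T] by simp
  moreover have "poly (typeII p T n) 0 \<noteq> 0"
    unfolding typeII_at_zero[OF band T] using \<alpha> by (simp add: less_imp_neq[symmetric])
  moreover have "\<alpha> (1 + n * (p + 1)) > 0" using \<alpha> by simp
  moreover have "poly (pderiv f) x * poly g x - poly f x * poly (pderiv g) x
      = \<alpha> (1 + n * (p + 1)) * (poly (typeII p T n) 0)\<^sup>2"
    using True calculation(1) by (simp add: g_def pderiv_mult pderiv_pCons power2_eq_square)
  ultimately show ?thesis by simp
next
  case False
  with x have x: "x > 0" by simp
  let ?F = "ladder_poly p \<alpha> (Suc n * (p + 1))" and ?G = "ladder_poly p \<alpha> (n * (p + 1))"
  have f: "poly f y = y ^ Suc n * poly ?F (1 / y)" and g: "poly g y = y ^ Suc n * poly ?G (1 / y)"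
    if "y > 0" for y
    using that typeII_eq_ladder_poly[OF band T, of y] by (simp_all add: f_def g_def)
  have d: "poly (pderiv h) x =
      real (Suc n) * x ^ n * poly H (1 / x) - x ^ Suc n * poly (pderiv H) (1 / x) / x\<^sup>2"
    if "\<And>y. y > 0 \<Longrightarrow> poly h y = y ^ Suc n * poly H (1 / y)" for h H :: "real poly"
  proof (rule DERIV_unique)
    have "((\<lambda>y. y ^ Suc n * poly H (1 / y)) has_real_derivative
        real (Suc n) * x ^ n * poly H (1 / x) - x ^ Suc n * poly (pderiv H) (1 / x) / x\<^sup>2) (at x)"
    proof -
      have "((\<lambda>y. 1 / y) has_real_derivative - 1 / x\<^sup>2) (at x)"
        using x by (auto intro!: derivative_eq_intros simp: power2_eq_square)
      from DERIV_mult[OF DERIV_pow[of "Suc n"] DERIV_chain2[OF poly_DERIV this]]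
      show ?thesis by (rule DERIV_cong) simp
    qed
    then show "(poly h has_real_derivative
        real (Suc n) * x ^ n * poly H (1 / x) - x ^ Suc n * poly (pderiv H) (1 / x) / x\<^sup>2) (at x)"
      by (rule has_field_derivative_transform_within_open[where S = "{0<..}"]) (use x that in auto)
  qed (rule poly_DERIV)
  have df: "poly (pderiv f) x = real (Suc n) * x ^ n * poly ?F (1 / x)
      - x ^ Suc n * poly (pderiv ?F) (1 / x) / x\<^sup>2"
    by (rule d) (rule f)
  have dg: "poly (pderiv g) x = real (Suc n) * x ^ n * poly ?G (1 / x)
      - x ^ Suc n * poly (pderiv ?G) (1 / x) / x\<^sup>2"
    by (rule d) (rule g)
  define F G F' G' where "F = poly ?F (1 / x)" and "G = poly ?G (1 / x)"
    and "F' = poly (pderiv ?F) (1 / x)" and "G' = poly (pderiv ?G) (1 / x)"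
  have W: "F * G' - F' * G > 0"
    using ladder_poly_wronskian[where \<alpha> = \<alpha> and t = "1 / x" and p = p and m = "n * (p + 1)"] \<alpha> x p
    by (simp add: F_def G_def F'_def G'_def algebra_simps)
  have "poly (pderiv f) x * poly g x - poly f x * poly (pderiv g) x
      = (x ^ Suc n)\<^sup>2 / x\<^sup>2 * (F * G' - F' * G)"
    unfolding df dg f[OF x] g[OF x] F_def[symmetric] G_def[symmetric] F'_def[symmetric] G'_def[symmetric]
    using x by (simp add: field_simps power2_eq_square)
  also have "\<dots> > 0" using W x by simp
  finally show ?thesis .
qed

lemma poly_pos_beyond_roots:
  fixes g :: "real poly"
  assumes "lead_coeff g > 0" and "\<And>y. y > a \<Longrightarrow> poly g y \<noteq> 0" and "x > a"
  shows "poly g x > 0"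
proof (rule ccontr)
  assume "\<not> poly g x > 0"
  with assms(2,3) have neg: "poly g x < 0" by (meson linorder_neqE_linordered_idom)
  obtain n where n: "\<And>y. y \<ge> n \<Longrightarrow> poly g y \<ge> lead_coeff g"
    using poly_pinfty_gt_lc[OF assms(1)] by auto
  have "poly g (max n (x + 1)) > 0" using n[of "max n (x + 1)"] assms(1) by simp
  moreover have "x < max n (x + 1)" by linarith
  ultimately obtain y where "x < y" "poly g y = 0"
    using poly_IVT_pos[of x "max n (x + 1)" g] neg by blast
  with assms show False by auto
qed

text \<open>
  Where \<open>f\<close> has no zero, \<open>g / f\<close> is strictly monotone, because its derivative is the Wronskian up to
  a factor of fixed sign. So by Rolle \<open>f\<close> vanishes between consecutive zeros of \<open>g\<close>. At the largest
  zero of \<open>g\<close>, \<open>g' \<ge> 0\<close> and the Wronskian inequality force \<open>f < 0\<close>, and \<open>f\<close> is positive at infinity.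
\<close>

lemma root_after_root:
  fixes f g :: "real poly"
  assumes W: "\<And>x. x \<ge> 0 \<Longrightarrow> poly (pderiv f) x * poly g x - poly f x * poly (pderiv g) x > 0"
    and f: "lead_coeff f > 0" and g: "lead_coeff g > 0"
    and a: "a \<ge> 0" "poly g a = 0"
  shows "\<exists>r>a. poly f r = 0 \<and> (\<forall>b>a. poly g b = 0 \<longrightarrow> r < b)"
proof (cases "\<exists>b>a. poly g b = 0")
  case False
  have pos: "poly g x > 0" if "x > a" for x
    using poly_pos_beyond_roots[OF g, of a] False that by blast
  have "poly (pderiv g) a \<ge> 0"
  proof (rule ccontr)
    assume "\<not> poly (pderiv g) a \<ge> 0"
    then obtain d where "d > 0" "\<And>h. h > 0 \<Longrightarrow> h < d \<Longrightarrow> poly g (a + h) < poly g a"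
      using DERIV_neg_dec_right[OF poly_DERIV[of g a]] by auto
    from this(2)[of "d / 2"] this(1) pos[of "a + d / 2"] a show False by simp
  qed
  moreover have "poly f a * poly (pderiv g) a < 0" using W[of a] a by simp
  ultimately have "poly f a < 0" by (simp add: mult_less_0_iff)
  then have "\<exists>r>a. poly f r = 0"
    using poly_pos_beyond_roots[OF f, of a] poly_IVT_pos
    by (metis gt_ex poly_IVT_pos)
  with False show ?thesis by blast
next
  case True
  have "g \<noteq> 0" using g by auto
  define b where "b = Min {b. b > a \<and> poly g b = 0}"
  have fin: "finite {b. b > a \<and> poly g b = 0}"
    using poly_roots_finite[OF \<open>g \<noteq> 0\<close>] by (rule rev_finite_subset) auto
  have b: "b > a" "poly g b = 0" and least: "\<And>c. c > a \<Longrightarrow> poly g c = 0 \<Longrightarrow> b \<le> c"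
    using Min_in[OF fin] True Min_le[OF fin] unfolding b_def by auto
  have "\<exists>r. a < r \<and> r < b \<and> poly f r = 0"
  proof (rule ccontr)
    assume no: "\<not> ?thesis"
    have nz: "poly f x \<noteq> 0" if "a \<le> x" "x \<le> b" for x
      using no that W[of x] a b by (cases "x = a \<or> x = b") auto
    have der: "((\<lambda>x. poly g x / poly f x) has_real_derivative
       (poly (pderiv g) x * poly f x - poly g x * poly (pderiv f) x) / (poly f x * poly f x)) (at x)"
      if "a \<le> x" "x \<le> b" for x
      using nz[OF that] by (intro DERIV_divide poly_DERIV)
    have "\<exists>z. a < z \<and> z < b \<and> DERIV (\<lambda>x. poly g x / poly f x) z :> 0"
    proof (rule Rolle)
      show "continuous_on {a..b} (\<lambda>x. poly g x / poly f x)"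
        using nz by (intro continuous_intros) auto
      show "(\<lambda>x. poly g x / poly f x) differentiable (at x)" if "a < x" "x < b" for x
        using der[of x] that real_differentiable_def by auto
    qed (use a b in auto)
    then obtain z where z: "a < z" "z < b" "DERIV (\<lambda>x. poly g x / poly f x) z :> 0" by blast
    from DERIV_unique[OF z(3) der] z nz[of z] W[of z] a show False by (auto simp: algebra_simps)
  qed
  then show ?thesis using least by force
qed

text \<open>
  By induction on \<open>n\<close>: the \<open>n + 1\<close> distinct zeros of \<open>x B\<^sub>n\<close> are each followed by a zero of
  \<open>B\<^bsub>n+1\<^esub>\<close> that precedes the next one. This gives \<open>n + 1\<close> distinct positive zeros, which by the degree are all.
  In particular the zeros are simple; directly, the Wronskian reduces to \<open>x B\<^bsub>n-1\<^esub> B\<^sub>n'\<close> at a zero of \<open>B\<^sub>n\<close>.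
\<close>

lemma typeII_zeros:
  assumes band: "monic_banded_hessenberg p T" and fac: "positive_bidiagonal_factorization p T" and p: "p \<ge> 1"
  shows "card {x. poly (typeII p T n) x = 0} = n \<and> (\<forall>x. poly (typeII p T n) x = 0 \<longrightarrow> x > 0)"
    and "poly (typeII p T n) a = 0 \<Longrightarrow> \<exists>r>a. poly (typeII p T (Suc n)) r = 0"
    and "poly (typeII p T n) a = 0 \<Longrightarrow> poly (pderiv (typeII p T n)) a \<noteq> 0"
proof -
  obtain \<alpha> where \<alpha>: "\<And>i. i \<ge> 1 \<Longrightarrow> \<alpha> i > 0"
    and T: "T = foldr smat_mult (map (lower_bidiag p \<alpha>) [1..<p + 1]) (upper_bidiag p \<alpha>)"
    using fac unfolding positive_bidiagonal_factorization_def by blast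
  let ?B = "typeII p T" and ?g = "\<lambda>n. [:0, 1:] * typeII p T n"
  note W = typeII_wronskian_pos[OF band T \<alpha> p]
  have lg: "lead_coeff (?g n) > 0" for n
    by (subst lead_coeff_mult) simp
  have ex: "\<exists>r>a. poly (?B (Suc n)) r = 0 \<and> (\<forall>b>a. poly (?g n) b = 0 \<longrightarrow> r < b)"
    if "a \<ge> 0" "poly (?g n) a = 0" for a n
    using root_after_root[OF W _ lg that] by simp
  have main: "card {x. poly (?B n) x = 0} = n \<and> (\<forall>x. poly (?B n) x = 0 \<longrightarrow> x > 0)" for n
  proof (induction n)
    case (Suc n)
    let ?A = "insert 0 {x. poly (?B n) x = 0}" and ?R = "{x. poly (?B (Suc n)) x = 0}"
    have fin: "finite {x. poly (?B n) x = 0}" "finite ?R"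
      using poly_roots_finite typeII_nonzero by blast+
    have A: "card ?A = Suc n" using Suc fin by (subst card_insert_disjoint) auto
    have "\<forall>a\<in>?A. \<exists>r>a. poly (?B (Suc n)) r = 0 \<and> (\<forall>b>a. poly (?g n) b = 0 \<longrightarrow> r < b)"
      using ex Suc by (auto simp: less_imp_le)
    then obtain r where r: "\<And>a. a \<in> ?A \<Longrightarrow>
        r a > a \<and> poly (?B (Suc n)) (r a) = 0 \<and> (\<forall>b>a. poly (?g n) b = 0 \<longrightarrow> r a < b)"
      by metis
    \<comment> \<open>\<open>r a\<close> lies below the next zero of \<open>x B\<^sub>n\<close>, hence below \<open>b\<close>.\<close>
    have lt: "r a < r b" if "a \<in> ?A" "b \<in> ?A" "a < b" for a b
    proof -
      have "r a < b" using r[OF that(1)] that by auto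
      also have "b < r b" using r[OF that(2)] by simp
      finally show ?thesis .
    qed
    have inj: "inj_on r ?A"
      by (rule inj_onI) (metis lt linorder_less_linear less_irrefl)
    have sub: "r ` ?A \<subseteq> ?R" using r by (auto)
    have "Suc n \<le> card ?R" using card_mono[OF fin(2) sub] card_image[OF inj] A by simp
    moreover have "card ?R \<le> Suc n"
      using poly_roots_degree[OF typeII_nonzero, of p T "Suc n"] by simp
    ultimately have R: "card ?R = Suc n" by (rule antisym[rotated])
    then have img: "r ` ?A = ?R"
      using card_subset_eq[OF fin(2) sub] card_image[OF inj] A by (simp only:)
    have pos: "r a > 0" if "a \<in> ?A" for a
    proof -
      have "a \<ge> 0" using that Suc by (auto simp: less_imp_le)
      also have "a < r a" using r[OF that] by blast
      finally show ?thesis .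
    qed
    show ?case
    proof (intro conjI allI impI R)
      fix x assume "poly (?B (Suc n)) x = 0"
      then have "x \<in> r ` ?A" unfolding img by (rule CollectI)
      then show "x > 0" using pos by blast
    qed
  qed simp
  show "card {x. poly (?B n) x = 0} = n \<and> (\<forall>x. poly (?B n) x = 0 \<longrightarrow> x > 0)" by (rule main)
  show "\<exists>r>a. poly (?B (Suc n)) r = 0" if "poly (?B n) a = 0"
    using ex[of a n] main[of n] that by (auto simp: less_imp_le)
  show "poly (pderiv (?B n)) a \<noteq> 0" if "poly (?B n) a = 0"
  proof (cases n)
    case 0
    then show ?thesis using that by simp
  next
    case (Suc m)
    have "a > 0" using main that by blast
    then show ?thesis using W[of a m] that Suc by auto
  qed
qed

text \<open>
  The largest zeros increase strictly with the degree, so at and beyond the largest zero of \<open>B\<^sub>m\<close> the earlier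
  polynomials have no zeros left, and they are monic.
\<close>

lemma typeII_pos:
  assumes band: "monic_banded_hessenberg p T" and fac: "positive_bidiagonal_factorization p T" and p: "p \<ge> 1"
    and top: "\<And>x. poly (typeII p T m) x = 0 \<Longrightarrow> x \<le> y" and "n < m"
  shows "poly (typeII p T n) y > 0"
proof -
  have le: "\<forall>x. poly (typeII p T k) x = 0 \<longrightarrow> x \<le> y" if "k \<le> m" for k
    using that
  proof (induction rule: inc_induct)
    case base
    then show ?case using top by blast
  next
    case (step k)
    then show ?case using typeII_zeros(2)[OF band fac p] by (meson less_imp_le order_trans)
  qed
  have lt: "x < y" if root: "poly (typeII p T n) x = 0" for x
    using typeII_zeros(2)[OF band fac p root] le[of "Suc n"] \<open>n < m\<close> by fastforce
  \<comment> \<open>Any number below \<open>y\<close> will do if there is no zero, which happens for \<open>n = 0\<close>.\<close>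
  define x where "x = (if {x. poly (typeII p T n) x = 0} = {} then y - 1 else Max {x. poly (typeII p T n) x = 0})"
  have fin: "finite {x. poly (typeII p T n) x = 0}"
    using poly_roots_finite typeII_nonzero by blast
  have "x < y" using lt Max_in[OF fin] by (auto simp: x_def)
  moreover have "poly (typeII p T n) z \<noteq> 0" if "z > x" for z
    using that Max_ge[OF fin] by (force simp: x_def split: if_splits)
  ultimately show ?thesis using poly_pos_beyond_roots[of "typeII p T n" x y] by simp
qed


section \<open>Truncated polynomials and the Christoffel-Darboux identity\<close>

text \<open>
  Laplace expansion along the first column. Removing row \<open>i\<close> and the first column of a Hessenberg matrix leaves a
  block lower triangular matrix: an \<open>i \<times> i\<close> triangular block with diagonal entries \<open>-1\<close>, whose
  determinant cancels the sign of the cofactor, and the trailing block that starts at \<open>i + 1\<close>.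
\<close>

lemma trunc_poly_recurrence:
  assumes band: "monic_banded_hessenberg p T" and k: "k \<le> N"
  shows "trunc_poly T N k = [:0, 1:] * trunc_poly T N (Suc k)
    - (\<Sum>i\<in>{k..N}. Polynomial.smult (T i k) (trunc_poly T N (Suc i)))"
proof -
  let ?X = "\<lambda>k. char_poly_matrix (trunc_mat T N k)"
  let ?M = "?X k"
  define n where "n = N - k"
  have n: "N + 1 - k = Suc n" using k by (simp add: n_def)
  have T1: "T i (Suc i) = 1" and T0: "Suc i < j \<Longrightarrow> T i j = 0" for i j
    using band by (auto simp: monic_banded_hessenberg_def)
  have X: "?X l \<in> carrier_mat (N + 1 - l) (N + 1 - l)" for l
    by (simp add: trunc_mat_def)
  have ent: "?X l $$ (r, c) = (if r = c then [:0, 1:] else 0) - [:T (l + r) (l + c):]"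
    if "r < N + 1 - l" "c < N + 1 - l" for l r c
    using that by (auto simp: char_poly_matrix_def trunc_mat_def)
  have minor: "det (mat_delete ?M i 0) = (- 1) ^ i * trunc_poly T N (k + Suc i)" if i: "i < Suc n" for i
  proof -
    define A where "A = Matrix.mat i i (\<lambda>(r, c). ?M $$ (r, Suc c))"
    define C where "C = Matrix.mat (n - i) i (\<lambda>(r, c). ?M $$ (Suc (i + r), Suc c))"
    have D: "?X (k + Suc i) \<in> carrier_mat (n - i) (n - i)"
      using X[of "k + Suc i"] n by (simp add: Suc_diff_Suc n_def)
    have "mat_delete ?M i 0 = four_block_mat A (0\<^sub>m i (n - i)) C (?X (k + Suc i))" (is "_ = ?F")
    proof (rule eq_matI)
      fix r c assume "r < dim_row ?F" "c < dim_col ?F"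
      then have rc: "r < n" "c < n" using D i by (auto simp: A_def)
      have dn: "N - k = n" "N - (k + i) = n - i" by (simp_all add: n_def)
      have Mdim: "dim_row ?M = Suc n" "dim_col ?M = Suc n" using X[of k] n by auto
      have Xdim: "dim_row (?X (k + Suc i)) = n - i" "dim_col (?X (k + Suc i)) = n - i" using D by auto
      have e1: "?M $$ (r, Suc c) = 0" if "r < i" "\<not> c < i"
        using that rc n T0[of "k + r" "k + Suc c"] by (subst ent) auto
      have e2: "?M $$ (Suc r, Suc c) = ?X (k + Suc i) $$ (r - i, c - i)" if "\<not> r < i" "\<not> c < i"
        using that rc n dn by (subst (1 2) ent) auto
      show "mat_delete ?M i 0 $$ (r, c) = ?F $$ (r, c)"
        using rc i e1 e2 Xdim by (auto simp: mat_delete_def Mdim A_def C_def)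
    qed (use i D X[of k] n in \<open>auto simp: A_def mat_delete_def\<close>)
    moreover have "det A = (- 1) ^ i"
    proof -
      have "det A = prod_list (diag_mat A)"
      proof (rule det_lower_triangular)
        show "A $$ (r, c) = 0" if "r < c" "c < i" for r c
          using that i n T0[of "k + r" "k + Suc c"] by (auto simp: A_def ent)
      qed (simp add: A_def)
      also have "diag_mat A = replicate i (- 1)"
        using i n T1 by (intro nth_equalityI) (auto simp: diag_mat_def A_def ent)
      finally show ?thesis by simp
    qed
    ultimately show ?thesis
      using det_four_block_mat_upper_right_zero[of A i "0\<^sub>m i (n - i)" "n - i" C "?X (k + Suc i)"] D
      by (simp add: A_def C_def trunc_poly_def char_poly_def)
  qed
  have "trunc_poly T N k = det ?M" by (simp add: trunc_poly_def char_poly_def)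
  also have "\<dots> = (\<Sum>i<Suc n. ?M $$ (i, 0) * cofactor ?M i 0)"
    by (rule laplace_expansion_column) (use X[of k] n in auto)
  also have "\<dots> = (\<Sum>i<Suc n. (if i = 0 then [:0, 1:] * trunc_poly T N (Suc k) else 0)
      - Polynomial.smult (T (k + i) k) (trunc_poly T N (k + Suc i)))"
  proof (rule sum.cong)
    fix i assume "i \<in> {..<Suc n}"
    then have i: "i < Suc n" by simp
    have "(- 1 :: real poly) ^ i * ((- 1) ^ i * q) = q" for q
      by (simp add: mult.assoc [symmetric] power_mult_distrib [symmetric])
    then show "?M $$ (i, 0) * cofactor ?M i 0 = (if i = 0 then [:0, 1:] * trunc_poly T N (Suc k) else 0)
      - Polynomial.smult (T (k + i) k) (trunc_poly T N (k + Suc i))"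
      using i n by (auto simp: cofactor_def minor ent algebra_simps)
  qed simp
  also have "\<dots> = [:0, 1:] * trunc_poly T N (Suc k)
      - (\<Sum>i<Suc n. Polynomial.smult (T (k + i) k) (trunc_poly T N (k + Suc i)))"
    by (simp add: sum_subtractf del: sum.lessThan_Suc)
  also have "(\<Sum>i<Suc n. Polynomial.smult (T (k + i) k) (trunc_poly T N (k + Suc i)))
      = (\<Sum>i\<in>{k..N}. Polynomial.smult (T i k) (trunc_poly T N (Suc i)))"
    by (rule sum.reindex_bij_witness[of _ "\<lambda>i. i - k" "\<lambda>i. k + i"]) (use k in \<open>auto simp: n_def\<close>)
  finally show ?thesis .
qed

lemma typeII_right_equation:
  assumes "monic_banded_hessenberg p T" and "i \<le> N"
  shows "(\<Sum>j\<le>N. T i j * poly (typeII p T j) x) =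
    x * poly (typeII p T i) x - (if i = N then poly (typeII p T (Suc N)) x else 0)"
proof (cases "i = N")
  case True
  have "T N (Suc N) = 1" using assms by (simp add: monic_banded_hessenberg_def)
  with typeII_recurrence[OF assms(1), of N x] True show ?thesis by simp
next
  case False
  have "(\<Sum>j\<le>N. T i j * poly (typeII p T j) x) = (\<Sum>j\<le>Suc i. T i j * poly (typeII p T j) x)"
    using assms False by (intro sum.mono_neutral_right) (auto simp: monic_banded_hessenberg_def)
  with typeII_recurrence[OF assms(1), of i x] False show ?thesis by simp
qed

text \<open>
  The mirror image of the recurrence of the type II polynomials: the vector of truncated polynomials is a left
  eigenvector of the finite section up to a multiple of the first unit vector.
\<close>

lemma trunc_poly_left_equation:
  assumes band: "monic_banded_hessenberg p T" and j: "j \<le> N"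
  shows "(\<Sum>i\<le>N. poly (trunc_poly T N (Suc i)) y * T i j) =
    y * poly (trunc_poly T N (Suc j)) y - (if j = 0 then poly (trunc_poly T N 0) y else 0)"
proof -
  let ?t = "\<lambda>k. poly (trunc_poly T N k) y"
  have rec: "(\<Sum>i\<in>{j..N}. ?t (Suc i) * T i j) = y * ?t (Suc j) - ?t j"
    using arg_cong[OF trunc_poly_recurrence[OF band j], of "\<lambda>q. poly q y"]
    by (simp add: poly_sum mult.commute)
  have "(\<Sum>i\<le>N. ?t (Suc i) * T i j) = (\<Sum>i\<in>{j - 1..N}. ?t (Suc i) * T i j)"
    using band by (intro sum.mono_neutral_right) (auto simp: monic_banded_hessenberg_def)
  also have "\<dots> = (if j = 0 then 0 else ?t j) + (\<Sum>i\<in>{j..N}. ?t (Suc i) * T i j)"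
  proof (cases j)
    case (Suc m)
    have "T m j = 1" using band Suc by (simp add: monic_banded_hessenberg_def)
    then show ?thesis using Suc j by (simp add: sum.atLeast_Suc_atMost[of m])
  qed simp
  finally show ?thesis using rec by auto
qed

text \<open>
  Both sides are what remains of \<open>\<psi>(y) (T B(x)) = (\<psi>(y) T) B(x)\<close> after the two eigenvector equations are
  inserted, where \<open>B\<close> and \<open>\<psi>\<close> are the vectors of type II and of truncated polynomials.
\<close>

lemma christoffel_darboux:
  assumes band: "monic_banded_hessenberg p T"
  shows "(x - y) * (\<Sum>j\<le>N. poly (trunc_poly T N (Suc j)) y * poly (typeII p T j) x)
    = poly (typeII p T (Suc N)) x - poly (trunc_poly T N 0) y"
proof -
  let ?t = "\<lambda>k. poly (trunc_poly T N k) y" and ?B = "\<lambda>k. poly (typeII p T k) x"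
  have "(\<Sum>i\<le>N. ?t (Suc i) * (\<Sum>j\<le>N. T i j * ?B j)) = (\<Sum>j\<le>N. (\<Sum>i\<le>N. ?t (Suc i) * T i j) * ?B j)"
    unfolding sum_distrib_left sum_distrib_right by (subst sum.swap) (simp only: mult.assoc)
  also have "(\<Sum>i\<le>N. ?t (Suc i) * (\<Sum>j\<le>N. T i j * ?B j))
      = (\<Sum>i\<le>N. x * (?t (Suc i) * ?B i) - (if i = N then ?t (Suc N) * ?B (Suc N) else 0))"
    by (rule sum.cong) (auto simp: typeII_right_equation[OF band] algebra_simps)
  also have "\<dots> = x * (\<Sum>j\<le>N. ?t (Suc j) * ?B j) - ?B (Suc N)"
    using trunc_poly_last[of T N] by (simp add: sum_subtractf sum_distrib_left)
  also have "(\<Sum>j\<le>N. (\<Sum>i\<le>N. ?t (Suc i) * T i j) * ?B j)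
      = (\<Sum>j\<le>N. y * (?t (Suc j) * ?B j) - (if j = 0 then ?t 0 else 0))"
  proof (rule sum.cong)
    fix j assume "j \<in> {..N}"
    then show "(\<Sum>i\<le>N. ?t (Suc i) * T i j) * ?B j = y * (?t (Suc j) * ?B j) - (if j = 0 then ?t 0 else 0)"
      using trunc_poly_left_equation[OF band, of j N y] by (cases "j = 0") simp_all
  qed simp
  also have "\<dots> = y * (\<Sum>j\<le>N. ?t (Suc j) * ?B j) - ?t 0"
    by (simp add: sum_subtractf sum_distrib_left)
  finally show ?thesis by (simp add: algebra_simps)
qed

text \<open>
  The diagonal \<open>x = y\<close> of the Christoffel-Darboux identity: \<open>B\<^bsub>N+1\<^esub>\<close> is the
  characteristic polynomial of the finite section.
\<close>

lemma trunc_poly_zero: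
  assumes "monic_banded_hessenberg p T"
  shows "trunc_poly T N 0 = typeII p T (Suc N)"
  using christoffel_darboux[OF assms, of y y N for y]
  by (intro poly_eqI_degree_lead_coeff poly_eq_poly_eq_iff[THEN iffD1] ext) simp

text \<open>
  Differentiate the Christoffel-Darboux identity with respect to \<open>x\<close> and put \<open>x = y\<close>.
\<close>

lemma typeII_trunc_poly_confluent:
  assumes band: "monic_banded_hessenberg p T"
  shows "(\<Sum>j\<le>N. poly (trunc_poly T N (Suc j)) y * poly (typeII p T j) y)
    = poly (pderiv (typeII p T (Suc N))) y"
proof -
  \<comment> \<open>\<open>y\<close> is a constant here, so that only \<open>x\<close> is a polynomial variable.\<close>
  define S where "S = (\<Sum>j\<le>N. Polynomial.smult (poly (trunc_poly T N (Suc j)) y) (typeII p T j))"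
  have S: "poly S x = (\<Sum>j\<le>N. poly (trunc_poly T N (Suc j)) y * poly (typeII p T j) x)" for x
    by (simp add: S_def poly_sum)
  have "poly ([:- y, 1:] * S + [:poly (trunc_poly T N 0) y:]) x = poly (typeII p T (Suc N)) x" for x
    using christoffel_darboux[OF band, of x y N] by (simp add: S algebra_simps)
  then have "[:- y, 1:] * S + [:poly (trunc_poly T N 0) y:] = typeII p T (Suc N)"
    by (intro poly_eq_poly_eq_iff[THEN iffD1] ext)
  from arg_cong[OF this, of "\<lambda>q. poly (pderiv q) y"] show ?thesis
    by (simp add: pderiv_add pderiv_mult pderiv_pCons S del: mult_pCons_left)
qed

section \<open>Eigenvectors of the finite section\<close>

text \<open>
  The unit superdiagonal lets the eigenvector equation be solved backwards from the last entry.
\<close>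

lemma left_eigenvector_unique:
  assumes band: "monic_banded_hessenberg p T"
    and v: "\<And>j. j \<le> N \<Longrightarrow> (\<Sum>i\<le>N. v i * T i j) = y * v j" and "j \<le> N"
  shows "v j = v N * poly (trunc_poly T N (Suc j)) y"
  using \<open>j \<le> N\<close>
proof (induction "N - j" arbitrary: j rule: less_induct)
  case less
  let ?t = "\<lambda>k. poly (trunc_poly T N k) y"
  show ?case
  proof (cases "j = N")
    case True
    then show ?thesis using trunc_poly_last[of T N] by simp
  next
    case False
    define k where "k = Suc j"
    have k: "k \<le> N" "j < k" using False less by (auto simp: k_def)
    have IH: "v i = v N * ?t (Suc i)" if "k \<le> i" "i \<le> N" for i
      by (rule less.hyps) (use that k in auto)
    have T1: "T j k = 1" using band by (simp add: monic_banded_hessenberg_def k_def)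
    have split: "(\<Sum>i\<le>N. f i * T i k) = f j + (\<Sum>i\<in>{k..N}. f i * T i k)" for f
    proof -
      have "(\<Sum>i\<le>N. f i * T i k) = (\<Sum>i\<in>{j..N}. f i * T i k)"
        using band by (intro sum.mono_neutral_right) (auto simp: monic_banded_hessenberg_def k_def)
      then show ?thesis using k T1 by (simp add: sum.atLeast_Suc_atMost[of j] k_def)
    qed
    have "v j = y * v k - (\<Sum>i\<in>{k..N}. v i * T i k)"
      using v[OF k(1)] unfolding split by linarith
    also have "(\<Sum>i\<in>{k..N}. v i * T i k) = v N * (\<Sum>i\<in>{k..N}. ?t (Suc i) * T i k)"
      unfolding sum_distrib_left
    proof (rule sum.cong)
      fix i assume "i \<in> {k..N}"
      then have "v i = v N * ?t (Suc i)" by (intro IH) auto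
      then show "v i * T i k = v N * (?t (Suc i) * T i k)" by simp
    qed simp
    also have "v k = v N * ?t (Suc k)" by (rule IH) (use k in auto)
    also have "y * (v N * ?t (Suc k)) - v N * (\<Sum>i\<in>{k..N}. ?t (Suc i) * T i k)
        = v N * (y * ?t (Suc k) - (\<Sum>i\<in>{k..N}. ?t (Suc i) * T i k))"
      by (simp add: algebra_simps)
    also have "y * ?t (Suc k) - (\<Sum>i\<in>{k..N}. ?t (Suc i) * T i k) = ?t (Suc j)"
      using trunc_poly_left_equation[OF band k(1), of y] k unfolding split by (simp add: k_def)
    finally show ?thesis .
  qed
qed

lemma right_eigenvector_unique:
  assumes band: "monic_banded_hessenberg p T"
    and v: "\<And>i. i \<le> N \<Longrightarrow> (\<Sum>j\<le>N. T i j * v j) = y * v i" and "n \<le> N"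
  shows "v n = v 0 * poly (typeII p T n) y"
  using \<open>n \<le> N\<close>
proof (induction n rule: less_induct)
  case (less n)
  show ?case
  proof (cases n)
    case (Suc m)
    have T1: "T m n = 1" using band Suc by (simp add: monic_banded_hessenberg_def)
    have "(\<Sum>j\<le>N. T m j * v j) = (\<Sum>j\<le>n. T m j * v j)"
      using band Suc less.prems by (intro sum.mono_neutral_right) (auto simp: monic_banded_hessenberg_def)
    then have "v n = y * v m - (\<Sum>j\<le>m. T m j * v j)"
      using v[of m] less.prems Suc T1 by simp
    also have "v m = v 0 * poly (typeII p T m) y"
      by (rule less.IH) (use less.prems Suc in auto)
    also have "(\<Sum>j\<le>m. T m j * v j) = v 0 * (\<Sum>j\<le>m. T m j * poly (typeII p T j) y)"
      unfolding sum_distrib_left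
    proof (rule sum.cong)
      fix j assume "j \<in> {..m}"
      then have "v j = v 0 * poly (typeII p T j) y" 
        by (intro less.IH) (use less.prems Suc in auto)
      then show "T m j * v j = v 0 * (T m j * poly (typeII p T j) y)" by simp
    qed simp
    also have "y * (v 0 * poly (typeII p T m) y) - v 0 * (\<Sum>j\<le>m. T m j * poly (typeII p T j) y)
        = v 0 * poly (typeII p T n) y"
    proof -
      have "(\<Sum>j\<le>m. T m j * poly (typeII p T j) y) = y * poly (typeII p T m) y - poly (typeII p T n) y"
        using typeII_recurrence[OF band, of m y] Suc T1 by simp
      then show ?thesis by (simp add: right_diff_distrib mult.left_commute)
    qed
    finally show ?thesis .
  qed simp
qed

text \<open>
  A Perron-Frobenius argument. Let \<open>v\<close> be the left eigenvector of truncated polynomials. Then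
  \<open>\<bar>v\<bar> T \<ge> y \<bar>v\<bar>\<close> entrywise, and pairing with the positive right eigenvector shows that equality holds. So
  \<open>\<bar>v\<bar>\<close> is a left eigenvector too; these are unique up to scaling and \<open>v\<close> ends with \<open>1\<close>, hence
  \<open>v = \<bar>v\<bar>\<close>. A zero entry would spread along the positive subdiagonal up to that last entry.
\<close>

lemma trunc_poly_pos:
  assumes band: "monic_banded_hessenberg p T"
    and nn: "\<And>i j. T i j \<ge> 0" and sub: "\<And>i. T (Suc i) i > 0"
    and root: "poly (typeII p T (Suc N)) y = 0" and y: "y > 0"
    and B: "\<And>n. n \<le> N \<Longrightarrow> poly (typeII p T n) y > 0" and "k \<le> N"
  shows "poly (trunc_poly T N (Suc k)) y > 0"
proof -
  let ?B = "\<lambda>n. poly (typeII p T n) y"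
  define v where "v i = poly (trunc_poly T N (Suc i)) y" for i
  have v: "(\<Sum>i\<le>N. v i * T i j) = y * v j" if "j \<le> N" for j
    using trunc_poly_left_equation[OF band that, of y] trunc_poly_zero[OF band, of N] root
    by (auto simp: v_def)
  have vN: "v N = 1" using trunc_poly_last[of T N] by (simp add: v_def)
  \<comment> \<open>The defect of \<open>\<bar>v\<bar>\<close> as a left eigenvector: nonnegative, and orthogonal to a positive vector.\<close>
  define e where "e j = (\<Sum>i\<le>N. \<bar>v i\<bar> * T i j) - y * \<bar>v j\<bar>" for j
  have e0: "e j \<ge> 0" if "j \<le> N" for j
  proof -
    have "y * \<bar>v j\<bar> = \<bar>\<Sum>i\<le>N. v i * T i j\<bar>" using v[OF that] y by (simp add: abs_mult)
    also have "\<dots> \<le> (\<Sum>i\<le>N. \<bar>v i\<bar> * T i j)"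
      by (rule order_trans[OF sum_abs]) (simp add: abs_mult nn)
    finally show ?thesis by (simp add: e_def)
  qed
  have right: "(\<Sum>j\<le>N. T i j * ?B j) = y * ?B i" if "i \<le> N" for i
    using typeII_right_equation[OF band that, of y] root by (simp split: if_splits)
  have "(\<Sum>j\<le>N. e j * ?B j) = (\<Sum>i\<le>N. \<bar>v i\<bar> * (\<Sum>j\<le>N. T i j * ?B j)) - (\<Sum>j\<le>N. y * \<bar>v j\<bar> * ?B j)"
    unfolding e_def left_diff_distrib sum_subtractf sum_distrib_left sum_distrib_right
    by (subst sum.swap) (simp only: mult.assoc)
  also have "\<dots> = 0"
    by (simp add: right mult.assoc mult.left_commute[of _ y])
  finally have "\<forall>j\<in>{..N}. e j * ?B j = 0"
    by (subst (asm) sum_nonneg_eq_0_iff) (auto intro!: mult_nonneg_nonneg e0 less_imp_le[OF B])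
  then have "e j = 0" if "j \<le> N" for j using B[OF that] that by force
  then have abs: "(\<Sum>i\<le>N. \<bar>v i\<bar> * T i j) = y * \<bar>v j\<bar>" if "j \<le> N" for j
    using that by (simp add: e_def)
  have v0: "v j \<ge> 0" if "j \<le> N" for j
    using left_eigenvector_unique[OF band abs that] vN by (simp add: v_def)
  have step: "v (Suc j) = 0" if "v j = 0" "Suc j \<le> N" for j
  proof -
    have "(\<Sum>i\<le>N. v i * T i j) = 0" using v[of j] that by simp
    then have "v (Suc j) * T (Suc j) j = 0"
      using that by (subst (asm) sum_nonneg_eq_0_iff) (auto intro: mult_nonneg_nonneg v0 nn)
    then show ?thesis using sub[of j] by simp
  qed
  have "v k \<noteq> 0"
  proof
    assume "v k = 0"
    have "v N = 0" using \<open>k \<le> N\<close>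
      by (induction rule: dec_induct) (use \<open>v k = 0\<close> step in auto)
    then show False using vN by simp
  qed
  then show ?thesis using v0[OF \<open>k \<le> N\<close>] by (simp add: v_def)
qed

lemma mat_inverse_eqI:
  fixes A B :: "real mat"
  assumes A: "A \<in> carrier_mat n n" and B: "B \<in> carrier_mat n n" and BA: "B * A = 1\<^sub>m n"
  shows "mat_inverse A = Some B"
proof -
  have AB: "A * B = 1\<^sub>m n" using mat_mult_left_right_inverse[OF B A BA] .
  have "A \<in> Units (ring_mat TYPE(real) n ())"
    using A B AB BA unfolding Units_def ring_mat_def by auto
  then obtain C where C: "mat_inverse A = Some C"
    using mat_inverse(1)[OF A, where b = "()"] by (cases "mat_inverse A") auto
  with mat_inverse(2)[OF A C] have "A * C = 1\<^sub>m n" "C \<in> carrier_mat n n" by auto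
  then have "C = B" using A B BA
    by (metis assoc_mult_mat left_mult_one_mat right_mult_one_mat)
  with C show ?thesis by simp
qed

text \<open>
  The decreasing list of zeros has exactly \<open>N + 1\<close> entries, so all the indices used are in range.
\<close>

lemma typeII_zero_props:
  assumes band: "monic_banded_hessenberg p T" and fac: "positive_bidiagonal_factorization p T" and p: "p \<ge> 1"
  shows "k < Suc N \<Longrightarrow> poly (typeII p T (Suc N)) (typeII_zero p T N (Suc k)) = 0"
    and "k < Suc N \<Longrightarrow> l < Suc N \<Longrightarrow> typeII_zero p T N (Suc k) = typeII_zero p T N (Suc l) \<longleftrightarrow> k = l"
    and "poly (typeII p T (Suc N)) x = 0 \<Longrightarrow> x \<le> typeII_zero p T N 1"
proof -
  let ?R = "{x. poly (typeII p T (N + 1)) x = 0}"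
  let ?l = "rev (sorted_list_of_set ?R)"
  have fin: "finite ?R" using poly_roots_finite typeII_nonzero by blast
  have len: "length ?l = Suc N"
    using typeII_zeros(1)[OF band fac p, of "Suc N"] fin by simp
  have set: "set ?l = ?R" using fin by simp
  have dist: "distinct ?l" by simp
  show "poly (typeII p T (Suc N)) (typeII_zero p T N (Suc k)) = 0" if "k < Suc N"
    using nth_mem[of k ?l] that len set unfolding typeII_zero_def by simp
  show "typeII_zero p T N (Suc k) = typeII_zero p T N (Suc l) \<longleftrightarrow> k = l" if "k < Suc N" "l < Suc N"
    using nth_eq_iff_index_eq[OF dist, of k l] that len unfolding typeII_zero_def by simp
  show "x \<le> typeII_zero p T N 1" if "poly (typeII p T (Suc N)) x = 0"
  proof -
    have "x \<in> set ?l" using that set by simp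
    then obtain i where i: "i < Suc N" "x = ?l ! i" using len by (metis in_set_conv_nth)
    have "sorted (rev ?l)" by simp
    then have "sorted_wrt (\<ge>) ?l" by (simp only: sorted_wrt_rev rev_rev_ident)
    then have "?l ! 0 \<ge> ?l ! i"
      using i len sorted_wrt_nth_less[of "(\<ge>)" ?l 0 i] by (cases "i = 0") auto
    then show ?thesis using i by (simp add: typeII_zero_def)
  qed
qed

text \<open>
  The matrix with these entries is a left inverse of the matrix of right eigenvectors: off the diagonal by the
  Christoffel-Darboux identity at two distinct zeros of \<open>B\<^bsub>N+1\<^esub>\<close>, on it by the confluent form.
\<close>

lemma left_evec_eq:
  assumes band: "monic_banded_hessenberg p T" and fac: "positive_bidiagonal_factorization p T" and p: "p \<ge> 1"
    and "k \<le> N" "n \<le> N"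
  shows "left_evec p T N (Suc k) (Suc n) =
    poly (trunc_poly T N (Suc n)) (typeII_zero p T N (Suc k))
      / poly (pderiv (typeII p T (Suc N))) (typeII_zero p T N (Suc k))"
proof -
  let ?z = "\<lambda>k. typeII_zero p T N (Suc k)"
  let ?d = "\<lambda>x. poly (pderiv (typeII p T (Suc N))) x"
  note z = typeII_zero_props[OF band fac p, where N = N]
  define W where "W = Matrix.mat (N + 1) (N + 1) (\<lambda>(i, j). poly (trunc_poly T N (Suc j)) (?z i) / ?d (?z i))"
  have U: "right_eigenmat p T N \<in> carrier_mat (N + 1) (N + 1)" by (simp add: right_eigenmat_def)
  have "W * right_eigenmat p T N = 1\<^sub>m (N + 1)"
  proof (rule eq_matI)
    fix i j assume "i < dim_row (1\<^sub>m (N + 1) :: real mat)" "j < dim_col (1\<^sub>m (N + 1) :: real mat)"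
    then have ij: "i < Suc N" "j < Suc N" by auto
    let ?S = "\<Sum>l\<le>N. poly (trunc_poly T N (Suc l)) (?z i) * poly (typeII p T l) (?z j)"
    have "(W * right_eigenmat p T N) $$ (i, j) = (\<Sum>l\<le>N. poly (trunc_poly T N (Suc l)) (?z i) / ?d (?z i) * poly (typeII p T l) (?z j))"
      using ij by (simp add: W_def right_eigenmat_def scalar_prod_def lessThan_Suc_atMost[symmetric] atLeast0LessThan
          del: sum.lessThan_Suc)
    also have "\<dots> = ?S / ?d (?z i)" by (simp add: sum_divide_distrib)
    also have "\<dots> = (if i = j then 1 else 0)"
    proof (cases "i = j")
      case True
      have "?d (?z i) \<noteq> 0" using typeII_zeros(3)[OF band fac p z(1)[OF ij(1)]] .
      then show ?thesis using True typeII_trunc_poly_confluent[OF band, of N "?z i"] by simp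
    next
      case False
      then have "?z j - ?z i \<noteq> 0" using z(2)[of i j] ij by auto
      moreover have "(?z j - ?z i) * ?S = 0"
        using christoffel_darboux[OF band, of "?z j" "?z i" N] trunc_poly_zero[OF band, of N] z(1) ij by simp
      ultimately show ?thesis using False by simp
    qed
    finally show "(W * right_eigenmat p T N) $$ (i, j) = 1\<^sub>m (N + 1) $$ (i, j)" using ij by simp
  qed (auto simp: W_def right_eigenmat_def)
  then have "left_eigenmat p T N = W"
    using mat_inverse_eqI[OF U, of W] by (simp add: left_eigenmat_def W_def)
  then show ?thesis using assms(4,5) by (simp add: left_evec_def W_def)
qed

section \<open>Type I polynomials and Christoffel numbers\<close>

text \<open>
  The recurrence can be solved for its last term because the entries \<open>T (n + p) n\<close> at the edge of the band do
  not vanish.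
\<close>

lemma typeI_recurrence_unique:
  fixes f g :: "nat \<Rightarrow> real"
  assumes p: "p \<ge> 1" and band: "monic_banded_hessenberg p T"
    and f: "\<And>n. n + p \<le> N \<Longrightarrow> (if n = 0 then 0 else f (n - 1)) + (\<Sum>i\<le>p. T (n + i) n * f (n + i)) = x * f n"
    and g: "\<And>n. n + p \<le> N \<Longrightarrow> (if n = 0 then 0 else g (n - 1)) + (\<Sum>i\<le>p. T (n + i) n * g (n + i)) = x * g n"
    and init: "\<And>n. n < p \<Longrightarrow> f n = g n" and "n \<le> N"
  shows "f n = g n"
  using \<open>n \<le> N\<close>
proof (induction n rule: less_induct)
  case (less n)
  show ?case
  proof (cases "n < p")
    case False
    define m where "m = n - p"
    have n: "n = m + p" using False by (simp add: m_def)
    have nz: "T n m \<noteq> 0" using band False by (simp add: monic_banded_hessenberg_def m_def)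
    have sums: "(\<Sum>i<p. T (m + i) m * f (m + i)) = (\<Sum>i<p. T (m + i) m * g (m + i))"
      using less n by (intro sum.cong) auto
    have prev: "(if m = 0 then 0 else f (m - 1)) = (if m = 0 then 0 else g (m - 1))"
      using less n by auto
    have fm: "f m = g m" using less n p by auto
    have mN: "m + p \<le> N" using less.prems n by simp
    have split: "(\<Sum>i\<le>p. T (m + i) m * h (m + i)) = (\<Sum>i<p. T (m + i) m * h (m + i)) + T n m * h n"
      for h :: "nat \<Rightarrow> real" by (simp add: n lessThan_Suc_atMost[symmetric])
    have "(if m = 0 then 0 else g (m - 1)) + ((\<Sum>i<p. T (m + i) m * g (m + i)) + T n m * f n) = x * g m"
      using f[OF mN] unfolding split prev sums fm .
    also have "\<dots> = (if m = 0 then 0 else g (m - 1)) + ((\<Sum>i<p. T (m + i) m * g (m + i)) + T n m * g n)"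
      using g[OF mN] unfolding split by (rule sym)
    finally have "T n m * f n = T n m * g n"
      by (simp only: add_left_cancel)
    then show ?thesis using nz by simp
  qed (use init in simp)
qed

lemma lower_unitriangular_inverse:
  assumes "lower_unitriangular p \<nu>"
  shows "the (mat_inverse \<nu>) \<in> carrier_mat p p" "\<nu> * the (mat_inverse \<nu>) = 1\<^sub>m p"
proof -
  have c: "\<nu> \<in> carrier_mat p p" using assms by (simp add: lower_unitriangular_def)
  have "det \<nu> = prod_list (diag_mat \<nu>)"
    using assms by (intro det_lower_triangular[OF _ c]) (auto simp: lower_unitriangular_def)
  also have "diag_mat \<nu> = replicate p 1"
    using assms by (intro nth_equalityI) (auto simp: diag_mat_def lower_unitriangular_def)
  finally have "det \<nu> \<noteq> 0" by simp
  then obtain B where "B \<in> carrier_mat p p" "B * \<nu> = 1\<^sub>m p"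
    using det_non_zero_imp_unit[OF c, of "()"] unfolding Units_def ring_mat_def by auto
  with mat_inverse_eqI[OF c this] mat_mult_left_right_inverse[OF this(1) c this(2)]
  show "the (mat_inverse \<nu>) \<in> carrier_mat p p" "\<nu> * the (mat_inverse \<nu>) = 1\<^sub>m p" by auto
qed

text \<open>
  Both sides, as sequences in \<open>n\<close>, satisfy the type I recurrence as long as it stays inside the finite section, and
  the Christoffel numbers are chosen such that the first \<open>p\<close> terms agree.
\<close>

lemma typeI_christoffel:
  assumes band: "monic_banded_hessenberg p T" and fac: "positive_bidiagonal_factorization p T" and p: "p \<ge> 1"
    and \<nu>: "lower_unitriangular p \<nu>" and N: "N \<ge> p - 1" and k: "k \<le> N" and n: "n \<le> N"
  shows "(\<Sum>a = 1..p. poly (typeI p T \<nu> a n) (typeII_zero p T N (Suc k)) * christoffel p T \<nu> N (Suc k) a)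
    = left_evec p T N (Suc k) (Suc n)"
proof -
  let ?z = "typeII_zero p T N (Suc k)" and ?w = "\<lambda>n. left_evec p T N (Suc k) (Suc n)"
  let ?\<mu> = "christoffel p T \<nu> N (Suc k)"
  define f where "f n = (\<Sum>a = 1..p. poly (typeI p T \<nu> a n) ?z * ?\<mu> a)" for n
  have root: "poly (typeII p T (Suc N)) ?z = 0"
    using typeII_zero_props(1)[OF band fac p] k by simp
  have "f n = ?w n"
  proof (rule typeI_recurrence_unique[OF p band _ _ _ n, where x = ?z])
    fix n assume "n + p \<le> N"
    have rec: "(if n = 0 then 0 else poly (typeI p T \<nu> a (n - 1)) ?z)
        + (\<Sum>i\<le>p. T (n + i) n * poly (typeI p T \<nu> a (n + i)) ?z) = ?z * poly (typeI p T \<nu> a n) ?z" for a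
      using arg_cong[OF typeI_recurrence[OF p band, of n \<nu> a], of "\<lambda>q. poly q ?z"]
      by (auto simp: poly_sum split: if_splits)
    have "?z * f n = (\<Sum>a = 1..p. (?z * poly (typeI p T \<nu> a n) ?z) * ?\<mu> a)"
      by (simp add: f_def sum_distrib_left mult.assoc)
    also have "\<dots> = (if n = 0 then 0 else f (n - 1)) + (\<Sum>a = 1..p. \<Sum>i\<le>p. T (n + i) n * poly (typeI p T \<nu> a (n + i)) ?z * ?\<mu> a)"
      unfolding rec[symmetric] by (simp add: f_def distrib_right sum.distrib sum_distrib_right)
    also have "(\<Sum>a = 1..p. \<Sum>i\<le>p. T (n + i) n * poly (typeI p T \<nu> a (n + i)) ?z * ?\<mu> a)
        = (\<Sum>i\<le>p. T (n + i) n * f (n + i))"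
      unfolding f_def sum_distrib_left by (subst sum.swap) (simp only: mult.assoc)
    finally show "(if n = 0 then 0 else f (n - 1)) + (\<Sum>i\<le>p. T (n + i) n * f (n + i)) = ?z * f n" by simp
  next
    fix n assume n: "n + p \<le> N"
    let ?t = "\<lambda>k. poly (trunc_poly T N k) ?z" and ?d = "poly (pderiv (typeII p T (Suc N))) ?z"
    have w: "?w i = ?t (Suc i) / ?d" if "i \<le> N" for i
      using left_evec_eq[OF band fac p k that] .
    have "(\<Sum>i\<le>N. ?t (Suc i) * T i n) = (\<Sum>i\<in>{n - 1..n + p}. ?t (Suc i) * T i n)"
      using band n by (intro sum.mono_neutral_right) (auto simp: monic_banded_hessenberg_def)
    also have "\<dots> = (if n = 0 then 0 else ?t n) + (\<Sum>i\<in>{n..n + p}. ?t (Suc i) * T i n)"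
    proof (cases n)
      case (Suc m)
      have "T m n = 1" using band Suc by (simp add: monic_banded_hessenberg_def)
      then show ?thesis using Suc by (simp add: sum.atLeast_Suc_atMost[of m])
    qed simp
    also have "(\<Sum>i\<in>{n..n + p}. ?t (Suc i) * T i n) = (\<Sum>i\<le>p. ?t (Suc (n + i)) * T (n + i) n)"
      by (rule sum.reindex_bij_witness[of _ "\<lambda>i. n + i" "\<lambda>i. i - n"]) auto
    finally have e: "(if n = 0 then 0 else ?t n) + (\<Sum>i\<le>p. ?t (Suc (n + i)) * T (n + i) n) = ?z * ?t (Suc n)"
      using trunc_poly_left_equation[OF band, of n N ?z] trunc_poly_zero[OF band, of N] root n by auto
    show "(if n = 0 then 0 else ?w (n - 1)) + (\<Sum>i\<le>p. T (n + i) n * ?w (n + i)) = ?z * ?w n"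
      using arg_cong[OF e, of "\<lambda>s. s / ?d"] n
      by (cases n) (simp_all add: w add_divide_distrib sum_divide_distrib mult.commute)
  next
    fix n assume n: "n < p"
    let ?u = "vec p ?w" and ?I = "the (mat_inverse \<nu>)"
    have I: "?I \<in> carrier_mat p p" "\<nu> * ?I = 1\<^sub>m p" using lower_unitriangular_inverse[OF \<nu>] by auto
    have c: "\<nu> \<in> carrier_mat p p" using \<nu> by (simp add: lower_unitriangular_def)
    have "f n = (\<Sum>a = 1..p. \<nu> $$ (n, a - 1) * (?I *\<^sub>v ?u) $ (a - 1))"
      using n by (simp add: f_def typeI_initial christoffel_def)
    also have "\<dots> = (\<Sum>a<p. \<nu> $$ (n, a) * (?I *\<^sub>v ?u) $ a)"
      by (rule sum.reindex_bij_witness[of _ Suc "\<lambda>a. a - 1"]) auto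
    also have "\<dots> = (\<nu> *\<^sub>v (?I *\<^sub>v ?u)) $ n"
      using n c I by (simp add: scalar_prod_def atLeast0LessThan)
    also have "\<nu> *\<^sub>v (?I *\<^sub>v ?u) = ?u"
      using assoc_mult_mat_vec[OF c I(1), of ?u] I(2) by simp
    finally show "f n = ?w n" using n by simp
  qed
  then show ?thesis by (simp add: f_def)
qed


section \<open>Stationary distributions\<close>

text \<open>
  Conjugating a nonnegative matrix by a positive right eigenvector \<open>r\<close> makes it stochastic, and \<open>v\<close> is fixed by
  the result exactly if \<open>v / r\<close> is a left eigenvector of \<open>M\<close>. The two matrices of the theorem are this
  construction for \<open>T\<close> and for its transpose, with the roles of \<open>l\<close> and \<open>r\<close> exchanged; as only the
  product of \<open>l\<close> and \<open>r\<close> enters the answer, they share their stationary distribution.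
\<close>

lemma doob_transform:
  fixes M :: "nat \<Rightarrow> nat \<Rightarrow> real" and r l :: "nat \<Rightarrow> real" and y :: real
  assumes y: "y > 0" and M: "\<And>i j. M i j \<ge> 0"
    and r: "\<And>i. i \<le> N \<Longrightarrow> r i > 0" and l: "\<And>i. i \<le> N \<Longrightarrow> l i > 0"
    and right: "\<And>i. i \<le> N \<Longrightarrow> (\<Sum>j\<le>N. M i j * r j) = y * r i"
    and left: "\<And>j. j \<le> N \<Longrightarrow> (\<Sum>i\<le>N. l i * M i j) = y * l j"
    and uniq: "\<And>v. (\<And>j. j \<le> N \<Longrightarrow> (\<Sum>i\<le>N. v i * M i j) = y * v j) \<Longrightarrow> \<exists>c. \<forall>j\<le>N. v j = c * l j"
  defines "P \<equiv> Matrix.mat (N + 1) (N + 1) (\<lambda>(i, j). M i j * r j / (y * r i))"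
    and "d \<equiv> \<Sum>j\<le>N. l j * r j"
  shows "stochastic_mat P"
    and "stationary_distribution P v \<longleftrightarrow> v = vec (N + 1) (\<lambda>j. l j * r j / d)"
proof -
  have dim: "dim_row P = Suc N" "dim_col P = Suc N" by (simp_all add: P_def)
  have ent: "P $$ (i, j) = M i j * r j / (y * r i)" if "i \<le> N" "j \<le> N" for i j
    using that by (simp add: P_def)
  have yr: "y * r i > 0" if "i \<le> N" for i using y r[OF that] by simp
  show "stochastic_mat P"
    unfolding stochastic_mat_def dim square_mat.simps
  proof (intro conjI allI impI)
    fix i j assume "i < Suc N" "j < Suc N"
    then have "i \<le> N" "j \<le> N" by auto
    then show "P $$ (i, j) \<ge> 0"
      using M[of i j] r[of j] yr[of i] by (simp add: ent)
  next
    fix i assume "i < Suc N"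
    then have i: "i \<le> N" by simp
    then have "(\<Sum>j\<le>N. P $$ (i, j)) = (\<Sum>j\<le>N. M i j * r j) / (y * r i)"
      by (simp add: ent sum_divide_distrib)
    also have "\<dots> = 1"
      unfolding right[OF i] by (rule divide_self) (use yr[OF i] in linarith)
    finally show "(\<Sum>j<Suc N. P $$ (i, j)) = 1" by (simp only: lessThan_Suc_atMost)
  qed simp
  have d: "d > 0" unfolding d_def by (intro sum_pos) (auto simp: l r)
  have mv: "transpose_mat P *\<^sub>v v = v \<longleftrightarrow> (\<forall>j\<le>N. (\<Sum>i\<le>N. v $ i / r i * M i j) = y * (v $ j / r j))"
    if v: "v \<in> carrier_vec (Suc N)" for v
  proof -
    have c: "(transpose_mat P *\<^sub>v v) $ j = (\<Sum>i\<le>N. v $ i / r i * M i j) * r j / y" if j: "j \<le> N" for j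
    proof -
      have "(transpose_mat P *\<^sub>v v) $ j = (\<Sum>i\<le>N. P $$ (i, j) * v $ i)"
        using j v dim by (simp add: scalar_prod_def atLeast0LessThan lessThan_Suc_atMost)
      also have "\<dots> = (\<Sum>i\<le>N. v $ i / r i * M i j * r j / y)"
        using j by (intro sum.cong) (simp_all add: ent ac_simps)
      finally show ?thesis by (simp add: sum_distrib_right sum_divide_distrib)
    qed
    have "transpose_mat P *\<^sub>v v = v \<longleftrightarrow> (\<forall>j\<le>N. (transpose_mat P *\<^sub>v v) $ j = v $ j)"
      using v dim by (auto simp: vec_eq_iff less_Suc_eq_le)
    also have "\<dots> \<longleftrightarrow> (\<forall>j\<le>N. (\<Sum>i\<le>N. v $ i / r i * M i j) = y * (v $ j / r j))"
    proof (intro all_cong imp_cong refl)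
      fix j assume "j \<le> N"
      then show "(transpose_mat P *\<^sub>v v) $ j = v $ j \<longleftrightarrow> (\<Sum>i\<le>N. v $ i / r i * M i j) = y * (v $ j / r j)"
        using y r[of j] by (auto simp: c field_simps)
    qed
    finally show ?thesis .
  qed
  let ?w = "vec (N + 1) (\<lambda>j. l j * r j / d)"
  show "stationary_distribution P v \<longleftrightarrow> v = ?w"
  proof
    assume st: "stationary_distribution P v"
    then have v: "v \<in> carrier_vec (Suc N)" by (simp add: stationary_distribution_def dim)
    have "\<exists>c. \<forall>j\<le>N. v $ j / r j = c * l j"
      using st mv[OF v] by (intro uniq) (auto simp: stationary_distribution_def)
    then obtain c where c: "\<And>j. j \<le> N \<Longrightarrow> v $ j / r j = c * l j" by blast
    have c: "v $ j = c * (l j * r j)" if "j \<le> N" for j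
      using c[OF that] r[OF that] by (simp add: field_simps)
    have "1 = (\<Sum>j\<le>N. v $ j)"
      using st v by (simp add: stationary_distribution_def lessThan_Suc_atMost)
    also have "\<dots> = c * d" by (simp add: c d_def sum_distrib_left)
    finally have "c = 1 / d" using d by (simp add: field_simps)
    then show "v = ?w" using v c by (intro eq_vecI) auto
  next
    assume v: "v = ?w"
    have "(\<Sum>j\<le>N. v $ j) = 1" using d by (simp add: v sum_divide_distrib[symmetric] d_def[symmetric])
    moreover have "transpose_mat P *\<^sub>v v = v"
    proof (subst mv)
      show "\<forall>j\<le>N. (\<Sum>i\<le>N. v $ i / r i * M i j) = y * (v $ j / r j)"
      proof (intro allI impI)
        fix j assume j: "j \<le> N"
        have x: "v $ i / r i = l i / d" if "i \<le> N" for i using r[OF that] that by (simp add: v)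
        have "(\<Sum>i\<le>N. v $ i / r i * M i j) = (\<Sum>i\<le>N. l i * M i j) / d"
          by (simp add: x sum_divide_distrib)
        then show "(\<Sum>i\<le>N. v $ i / r i * M i j) = y * (v $ j / r j)"
          using left[OF j] j by (simp add: x)
      qed
    qed (simp add: v)
    moreover have "v $ i \<ge> 0" if "i \<le> N" for i
      using that l[OF that] r[OF that] d by (simp add: v less_imp_le)
    ultimately show "stationary_distribution P v"
      using v by (simp add: stationary_distribution_def dim lessThan_Suc_atMost)
  qed
qed

theorem theorem10:
  fixes p N :: nat and T :: "nat \<Rightarrow> nat \<Rightarrow> real" and \<nu> :: "real mat"
  assumes "p \<ge> 1"
    and "monic_banded_hessenberg p T"
    and "positive_bidiagonal_factorization p T"
    and "associated_with_stochastic T"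
    and "lower_unitriangular p \<nu>"
    and "N \<ge> p - 1"
  shows "stochastic_mat (P_II p T N) \<and> stochastic_mat (P_I p T N) \<and>
    (\<exists>w :: real vec.
      (\<forall>v. stationary_distribution (P_II p T N) v \<longleftrightarrow> v = w) \<and>
      (\<forall>v. stationary_distribution (P_I p T N) v \<longleftrightarrow> v = w) \<and>
      (\<forall>n \<in> {1..N + 1}.
        w $ (n - 1) = right_evec p T N 1 n * left_evec p T N 1 n \<and>
        right_evec p T N 1 n * left_evec p T N 1 n =
          (\<Sum>a = 1..p. poly (typeI p T \<nu> a (n - 1)) (typeII_zero p T N 1) * christoffel p T \<nu> N 1 a)
            * poly (typeII p T (n - 1)) (typeII_zero p T N 1) \<and>
        (\<Sum>a = 1..p. poly (typeI p T \<nu> a (n - 1)) (typeII_zero p T N 1) * christoffel p T \<nu> N 1 a)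
            * poly (typeII p T (n - 1)) (typeII_zero p T N 1) =
          poly (trunc_poly T N n) (typeII_zero p T N 1) * poly (typeII p T (n - 1)) (typeII_zero p T N 1)
            / poly (pderiv (typeII p T (N + 1))) (typeII_zero p T N 1)))"
proof -
  note p = assms(1) and band = assms(2) and fac = assms(3)
  define y where "y = typeII_zero p T N 1"
  define r where "r n = poly (typeII p T n) y" for n
  define l where "l n = poly (trunc_poly T N (Suc n)) y" for n
  define d where "d = poly (pderiv (typeII p T (N + 1))) y"
  note z = typeII_zero_props[OF band fac p, where N = N]
  note entries = positive_bidiagonal_factorization_entries[OF fac p]
  have root: "poly (typeII p T (Suc N)) y = 0" using z(1)[of 0] by (simp add: y_def)
  have y: "y > 0" using typeII_zeros(1)[OF band fac p] root by blast
  have rpos: "r n > 0" if "n \<le> N" for n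
    unfolding r_def by (rule typeII_pos[OF band fac p, where m = "Suc N"]) (use z(3) that in \<open>auto simp: y_def\<close>)
  have lpos: "l n > 0" if "n \<le> N" for n
    unfolding l_def by (rule trunc_poly_pos[OF band entries root y rpos[unfolded r_def] that])
  have right: "(\<Sum>j\<le>N. T i j * r j) = y * r i" if "i \<le> N" for i
    using typeII_right_equation[OF band that, of y] root by (simp add: r_def split: if_splits)
  have left: "(\<Sum>i\<le>N. l i * T i j) = y * l j" if "j \<le> N" for j
    using trunc_poly_left_equation[OF band that, of y] trunc_poly_zero[OF band, of N] root
    by (simp add: l_def split: if_splits)
  have dsum: "(\<Sum>j\<le>N. l j * r j) = d"
    using typeII_trunc_poly_confluent[OF band, of N y] by (simp add: d_def l_def r_def)
  have diag: "mat_diag (N + 1) f * (c \<cdot>\<^sub>m A) * mat_diag (N + 1) g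
      = Matrix.mat (N + 1) (N + 1) (\<lambda>(i, j). f i * (c * A $$ (i, j)) * g j)"
    if "A \<in> carrier_mat (N + 1) (N + 1)" for A :: "real mat" and f g c
    using that by (subst mat_diag_mult_left[of _ _ "N + 1"], force, subst mat_diag_mult_right[of _ "N + 1"])
      (auto intro!: eq_matI)
  have tc: "trunc_mat T N 0 \<in> carrier_mat (N + 1) (N + 1)" by (simp add: trunc_mat_def)
  let ?PII = "Matrix.mat (N + 1) (N + 1) (\<lambda>(i, j). T i j * r j / (y * r i))"
  let ?PI = "Matrix.mat (N + 1) (N + 1) (\<lambda>(i, j). T j i * l j / (y * l i))"
  have PII: "P_II p T N = ?PII"
    unfolding P_II_def diag[OF tc]
    by (intro eq_matI) (auto simp: pi_II_def trunc_mat_def r_def y_def)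
  have "l 0 \<noteq> 0" using lpos[of 0] by simp
  then have PI: "P_I p T N = ?PI"
    unfolding P_I_def diag[OF transpose_carrier_mat[THEN iffD2, OF tc]]
    by (intro eq_matI) (auto simp: pi_I_def trunc_mat_def l_def y_def field_simps)
  define w where "w = vec (N + 1) (\<lambda>j. l j * r j / d)"
  have II: "stochastic_mat ?PII" "stationary_distribution ?PII v \<longleftrightarrow> v = w" for v
  proof -
    have u: "\<exists>c. \<forall>j\<le>N. v j = c * l j" if "\<And>j. j \<le> N \<Longrightarrow> (\<Sum>i\<le>N. v i * T i j) = y * v j" for v
    proof (intro exI allI impI)
      show "v j = v N * l j" if "j \<le> N" for j
        unfolding l_def by (rule left_eigenvector_unique[OF band _ that]) fact
    qed
    note D = doob_transform[of y T N r l, OF y entries(1) rpos lpos right left u]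
    show "stochastic_mat ?PII" by (rule D(1))
    show "stationary_distribution ?PII v \<longleftrightarrow> v = w" using D(2)[of v] unfolding dsum w_def .
  qed
  have I: "stochastic_mat ?PI" "stationary_distribution ?PI v \<longleftrightarrow> v = w" for v
  proof -
    have u: "\<exists>c. \<forall>j\<le>N. v j = c * r j" if ev: "\<And>j. j \<le> N \<Longrightarrow> (\<Sum>i\<le>N. v i * T j i) = y * v j" for v
    proof (intro exI allI impI)
      have e: "(\<Sum>i\<le>N. T j i * v i) = y * v j" if "j \<le> N" for j
        using ev[OF that] by (simp add: mult.commute)
      show "v j = v 0 * r j" if "j \<le> N" for j
        unfolding r_def by (rule right_eigenvector_unique[OF band e that])
    qed
    have right': "(\<Sum>i\<le>N. r i * T j i) = y * r j" if "j \<le> N" for j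
      using right[OF that] by (simp add: mult.commute)
    have left': "(\<Sum>j\<le>N. T j i * l j) = y * l i" if "i \<le> N" for i
      using left[OF that] by (simp add: mult.commute)
    note D = doob_transform[of y "\<lambda>i j. T j i" N l r, OF y entries(1) lpos rpos left' right' u]
    show "stochastic_mat ?PI" by (rule D(1))
    show "stationary_distribution ?PI v \<longleftrightarrow> v = w"
      using D(2)[of v] dsum by (simp add: w_def mult.commute)
  qed
  have formulas: "w $ (n - 1) = right_evec p T N 1 n * left_evec p T N 1 n \<and>
        right_evec p T N 1 n * left_evec p T N 1 n =
          (\<Sum>a = 1..p. poly (typeI p T \<nu> a (n - 1)) y * christoffel p T \<nu> N 1 a) * poly (typeII p T (n - 1)) y \<and>
        (\<Sum>a = 1..p. poly (typeI p T \<nu> a (n - 1)) y * christoffel p T \<nu> N 1 a) * poly (typeII p T (n - 1)) y =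
          poly (trunc_poly T N n) y * poly (typeII p T (n - 1)) y / d"
    if "n \<in> {1..N + 1}" for n
  proof -
    define m where "m = n - 1"
    have m: "n = Suc m" "m \<le> N" using that by (auto simp: m_def)
    have le: "left_evec p T N 1 n = l m / d"
      using left_evec_eq[OF band fac p, of 0 N m] m by (simp add: l_def d_def y_def)
    have re: "right_evec p T N 1 n = r m"
      using m by (simp add: right_evec_def right_eigenmat_def r_def y_def)
    have ty: "(\<Sum>a = 1..p. poly (typeI p T \<nu> a m) y * christoffel p T \<nu> N 1 a) = left_evec p T N 1 n"
      using typeI_christoffel[OF band fac p assms(5,6), of 0 m] m by (simp add: y_def)
    have wm: "w $ m = l m * r m / d" using m by (simp add: w_def)
    show ?thesis unfolding m_def[symmetric] ty re le wm r_def[symmetric]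
      using m by (simp add: l_def)
  qed
  show ?thesis
    unfolding PII PI y_def[symmetric] d_def[symmetric]
    using formulas by (intro conjI exI[of _ w] allI ballI I II) blast+
qed

end
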